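(* Let $u$ be a smooth solution of the rotating Euler equations $$\partial_t u + u\cdot\nabla u + \nabla\pi + 2\Omega\, e_3\times u = 0,\qquad \nabla\cdot u = 0,$$ in $R$ with $u\cdot n=0$ on $\partial R$, let $X(a,t)$ be its Lagrangian path map, $\lambda(a,t)=X(a,t)-a$ the Lagrangian displacement, $\omega=\nabla\times u$ and $\zeta(a)=\omega(a,0)$. Assume that the local Rossby number is less than two, i.e. $|\zeta(a)|/\Omega<2$. Then $\lambda$ obeys the differential equation $$\partial_{a_3}\lambda_3(a,t)+\epsilon_1(a)\,\partial_{a_3}\lambda_1(a,t)+\epsilon_2(a)\,\partial_{a_3}\lambda_2(a,t)=\frac{1}{2\Omega\left(1+\frac{\zeta_3(a)}{2\Omega}\right)}\Big(\omega_3(X(a,t),t)-\zeta_3(a)\Big),$$ where, for $j=1,2$, $$\epsilon_j(a)=\frac{1}{2\Omega\left(1+\frac{\zeta_3(a)}{2\Omega}\right)}\,\zeta_j(a).$$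
   Context: $\Omega>0$ is a constant (angular velocity) and $e_3=\widehat z$ is the unit vector of the third Cartesian direction (the rotation axis). $R\subset\mathbb R^3$ is an open domain with smooth boundary $\partial R$ and normal $n$. The Lagrangian path map $X(a,t)$, $a\in R$, is the solution of $\partial_t X(a,t)=u(X(a,t),t)$, $X(a,0)=a$. The relative vorticity is $\omega=\nabla\times u$, and $\zeta(a)=\omega(a,0)$ is the initial relative vorticity at the label $a$. The local Rossby number is the ratio between the magnitude of the relative vorticity and $\Omega$, $\rho(a)=|\zeta(a)|/\Omega$.
   Formalization: The terms ε_1 ∂_{a_3}λ_1 and ε_2 ∂_{a_3}λ_2 are replaced by ε_1 ∂_{a_1}λ_3 and ε_2 ∂_{a_2}λ_3; the printed equation fails for u = Ωx_3(sin 2Ωt, cos 2Ωt, 0), π = 0, where |ζ|/Ω = 1. *)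

theory Defs
  imports "HOL-Analysis.Analysis"
begin

text \<open>Smoothness on an arbitrary set (such as a closed domain times a compact time interval) means
  having a \<open>C\<^sup>\<infinity>\<close> extension to an open neighbourhood; on an open set this is ordinary
  \<open>C\<^sup>\<infinity>\<close> smoothness.\<close>

primrec Ck_on :: "nat \<Rightarrow> 'a::real_normed_vector set \<Rightarrow> ('a \<Rightarrow> 'b::real_normed_vector) \<Rightarrow> bool" where
  "Ck_on 0 S f \<longleftrightarrow> continuous_on S f"
| "Ck_on (Suc k) S f \<longleftrightarrow> (\<forall>x\<in>S. f differentiable (at x)) \<and>
     (\<forall>v. Ck_on k S (\<lambda>x. frechet_derivative f (at x) v))"

definition smooth_on :: "'a::real_normed_vector set \<Rightarrow> ('a \<Rightarrow> 'b::real_normed_vector) \<Rightarrow> bool" where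
  "smooth_on S f \<longleftrightarrow> (\<exists>W g. open W \<and> S \<subseteq> W \<and> (\<forall>k. Ck_on k W g) \<and> (\<forall>x\<in>S. g x = f x))"

definition pderiv_vec :: "3 \<Rightarrow> (real^3 \<Rightarrow> 'b::real_normed_vector) \<Rightarrow> real^3 \<Rightarrow> 'b" where
  "pderiv_vec j f x = frechet_derivative f (at x) (axis j 1)"

definition grad :: "(real^3 \<Rightarrow> real) \<Rightarrow> real^3 \<Rightarrow> real^3" where
  "grad f x = (\<chi> j. pderiv_vec j f x)"

definition divergence :: "(real^3 \<Rightarrow> real^3) \<Rightarrow> real^3 \<Rightarrow> real" where
  "divergence v x = (\<Sum>j\<in>UNIV. pderiv_vec j (\<lambda>y. v y $ j) x)"

definition curl :: "(real^3 \<Rightarrow> real^3) \<Rightarrow> real^3 \<Rightarrow> real^3" where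
  "curl v x = vector
     [pderiv_vec 2 (\<lambda>y. v y $ 3) x - pderiv_vec 3 (\<lambda>y. v y $ 2) x,
      pderiv_vec 3 (\<lambda>y. v y $ 1) x - pderiv_vec 1 (\<lambda>y. v y $ 3) x,
      pderiv_vec 1 (\<lambda>y. v y $ 2) x - pderiv_vec 2 (\<lambda>y. v y $ 1) x]"

definition advection :: "(real^3 \<Rightarrow> real^3) \<Rightarrow> (real^3 \<Rightarrow> real^3) \<Rightarrow> real^3 \<Rightarrow> real^3" where
  "advection v w x = (\<Sum>j\<in>UNIV. (v x $ j) *\<^sub>R pderiv_vec j w x)"

definition local_defining_function ::
    "(real^3) set \<Rightarrow> real^3 \<Rightarrow> (real^3) set \<Rightarrow> (real^3 \<Rightarrow> real) \<Rightarrow> bool" where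
  "local_defining_function R p U \<phi> \<longleftrightarrow> open U \<and> p \<in> U \<and> smooth_on U \<phi> \<and>
     (\<forall>x\<in>U. grad \<phi> x \<noteq> 0) \<and> R \<inter> U = {x \<in> U. \<phi> x < 0}"

definition smooth_domain :: "(real^3) set \<Rightarrow> bool" where
  "smooth_domain R \<longleftrightarrow> open R \<and> connected R \<and> R \<noteq> {} \<and>
     (\<forall>p\<in>frontier R. \<exists>U \<phi>. local_defining_function R p U \<phi>)"

definition outward_unit_normal :: "(real^3) set \<Rightarrow> real^3 \<Rightarrow> real^3 \<Rightarrow> bool" where
  "outward_unit_normal R p n \<longleftrightarrow>
     (\<exists>U \<phi>. local_defining_function R p U \<phi> \<and> n = grad \<phi> p /\<^sub>R norm (grad \<phi> p))"

text \<open>A space-time field \<open>u\<close> takes the position first and the time second. The pressure \<open>\<pi>\<close>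
  is only required to be smooth in space at each time, since it is determined only up to an arbitrary
  function of time. At the endpoints of the time interval the time derivative is
  one-sided.\<close>

definition rotating_euler_solution ::
    "real \<Rightarrow> (real^3) set \<Rightarrow> real \<Rightarrow> (real^3 \<Rightarrow> real \<Rightarrow> real^3) \<Rightarrow> (real^3 \<Rightarrow> real \<Rightarrow> real) \<Rightarrow> bool" where
  "rotating_euler_solution \<Omega> R T u \<pi> \<longleftrightarrow>
     smooth_on (Sigma (closure R) (\<lambda>_. {0..T})) (\<lambda>(x, t). u x t) \<and>
     (\<forall>t\<in>{0..T}. smooth_on R (\<lambda>x. \<pi> x t)) \<and>
     (\<forall>x\<in>R. \<forall>t\<in>{0..T}.
        vector_derivative (\<lambda>s. u x s) (at t within {0..T})
          + advection (\<lambda>y. u y t) (\<lambda>y. u y t) x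
          + grad (\<lambda>y. \<pi> y t) x
          + (2 * \<Omega>) *\<^sub>R cross3 (axis 3 1) (u x t) = 0) \<and>
     (\<forall>x\<in>R. \<forall>t\<in>{0..T}. divergence (\<lambda>y. u y t) x = 0) \<and>
     (\<forall>p\<in>frontier R. \<forall>t\<in>{0..T}. \<forall>n. outward_unit_normal R p n \<longrightarrow> u p t \<bullet> n = 0)"

definition lagrangian_path_map ::
    "(real^3) set \<Rightarrow> real \<Rightarrow> (real^3 \<Rightarrow> real \<Rightarrow> real^3) \<Rightarrow> (real^3 \<Rightarrow> real \<Rightarrow> real^3) \<Rightarrow> bool" where
  "lagrangian_path_map R T u X \<longleftrightarrow> (\<forall>a\<in>R. X a 0 = a \<and>
     (\<forall>t\<in>{0..T}. X a t \<in> closure R \<and>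
        ((\<lambda>s. X a s) has_vector_derivative u (X a t) t) (at t within {0..T})))"

definition displacement :: "(real^3 \<Rightarrow> real \<Rightarrow> real^3) \<Rightarrow> real^3 \<Rightarrow> real \<Rightarrow> real^3" where
  "displacement X a t = X a t - a"

definition vorticity :: "(real^3 \<Rightarrow> real \<Rightarrow> real^3) \<Rightarrow> real^3 \<Rightarrow> real \<Rightarrow> real^3" where
  "vorticity u x t = curl (\<lambda>y. u y t) x"

definition initial_vorticity :: "(real^3 \<Rightarrow> real \<Rightarrow> real^3) \<Rightarrow> real^3 \<Rightarrow> real^3" where
  "initial_vorticity u a = vorticity u a 0"

definition local_rossby :: "real \<Rightarrow> (real^3 \<Rightarrow> real \<Rightarrow> real^3) \<Rightarrow> real^3 \<Rightarrow> real" where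
  "local_rossby \<Omega> u a = norm (initial_vorticity u a) / \<Omega>"

text \<open>The coefficients \<open>\<epsilon>\<^sub>j\<close> (\<open>j = 1, 2\<close>) multiply \<open>\<partial>\<^sub>j \<lambda>\<^sub>3\<close>, as in the third component
  of Cauchy's vorticity formula
  \<open>\<omega>(X) + 2\<Omega>e\<^sub>3 = ((\<zeta> + 2\<Omega>e\<^sub>3) \<cdot> \<nabla>) X\<close>. The identity with \<open>\<partial>\<^sub>3 \<lambda>\<^sub>j\<close> in their place
  is false: in the inertial oscillation
  \<open>u = \<Omega>x\<^sub>3 (sin 2\<Omega>t, cos 2\<Omega>t, 0)\<close>, \<open>\<pi> = 0\<close>, both \<open>\<lambda>\<^sub>3\<close> and \<open>\<omega>\<^sub>3\<close> vanish identically,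
  \<open>\<epsilon>\<^sub>1 = -1/2\<close>, \<open>\<epsilon>\<^sub>2 = 0\<close>, but \<open>\<partial>\<^sub>3 \<lambda>\<^sub>1 = (1 - cos 2\<Omega>t)/2\<close>.\<close>

definition eps :: "real \<Rightarrow> (real^3 \<Rightarrow> real \<Rightarrow> real^3) \<Rightarrow> 3 \<Rightarrow> real^3 \<Rightarrow> real" where
  "eps \<Omega> u j a = 1 / (2 * \<Omega> * (1 + initial_vorticity u a $ 3 / (2 * \<Omega>))) * initial_vorticity u a $ j"

end

theory Submission
  imports Defs
begin

text \<open>Write \<open>\<zeta> + 2\<Omega>e\<^sub>3\<close> for the initial absolute vorticity. The identity is the third component of Cauchy's
vorticity formula
\<open>\<nabla>X(a,t) (\<zeta>(a) + 2\<Omega>e\<^sub>3) = \<omega>(X(a,t),t) + 2\<Omega>e\<^sub>3\<close>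
(lemma \<open>cauchy_vorticity_formula\<close>): replacing \<open>X\<close> by \<open>a + \<lambda>\<close> turns it into
\<open>\<zeta>\<^sub>1 \<partial>\<^sub>1\<lambda>\<^sub>3 + \<zeta>\<^sub>2 \<partial>\<^sub>2\<lambda>\<^sub>3 + (\<zeta>\<^sub>3 + 2\<Omega>) \<partial>\<^sub>3\<lambda>\<^sub>3 = \<omega>\<^sub>3 - \<zeta>\<^sub>3\<close>, and the bound on the Rossby number makes
\<open>\<zeta>\<^sub>3 + 2\<Omega>\<close> positive, so that one may divide by it.

Cauchy's formula says that both sides solve the same linear ordinary differential equation
\<open>w' = \<nabla>u(X(a,t),t) w\<close> with the same initial value. For the right-hand side this is the vorticity
equation (\<open>absolute_vorticity_along_path\<close>): along a path the velocity gradient \<open>J\<close> satisfies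
\<open>J' = - J\<^sup>2 - H - 2\<Omega> (e\<^sub>3 \<times> J)\<close> with \<open>H\<close> the Hessian of the pressure, and in the antisymmetric part of this
matrix equation the symmetric \<open>H\<close> disappears while the trace of \<open>J\<close> vanishes
(\<open>curl_of_euler_rate\<close>). Equality of mixed derivatives (\<open>C2_dir_deriv_symmetric\<close>) enters twice, for the
velocity and for the pressure.

For the left-hand side one needs that \<open>X\<close> is differentiable in the label. No solution of the
variational equation has to be constructed for this. The deviation of a neighbouring path solves the
linear equation up to an error quadratic in the initial separation, so by Gronwall's inequality the
deviations at time \<open>t\<close> depend linearly on the separation up to a quadratic error, and such a map is
differentiable (\<open>differentiable_of_approximate_linearity\<close>). The same estimate, comparing a rescaled
deviation with any exact solution \<open>w\<close> of the linear equation, identifies the derivative in the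
direction \<open>w 0\<close> as \<open>w t\<close> (\<open>flow_derivative_transports\<close>).

All equations hold in the open set \<open>R\<close> only, whereas a path is a priori just in its closure. A path
starting in \<open>R\<close> stays in \<open>R\<close> (\<open>path_stays_inside\<close>): since \<open>u\<close> is tangent to the boundary, a defining
function \<open>\<phi>\<close> decays at most exponentially along the path, and hence cannot reach the value zero in
finite time.\<close>

section \<open>Functions of class C1 and C2\<close>

text \<open>The direction comes first, so that the derivative in a fixed direction is a function of the point
which can itself be differentiated.\<close>

abbreviation dir_deriv :: "'a::real_normed_vector \<Rightarrow> ('a \<Rightarrow> 'b::real_normed_vector) \<Rightarrow> 'a \<Rightarrow> 'b" where
  "dir_deriv v f x \<equiv> frechet_derivative f (at x) v"

lemma Ck_on_has_derivative:
  assumes "Ck_on (Suc k) W f" "x \<in> W"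
  shows "(f has_derivative (\<lambda>v. dir_deriv v f x)) (at x)"
  using assms by (simp add: frechet_derivative_works)

lemma Ck_on_dir_deriv: "Ck_on (Suc k) W f \<Longrightarrow> Ck_on k W (dir_deriv v f)"
  by simp

lemma Ck_on_continuous: "Ck_on k W f \<Longrightarrow> continuous_on W f"
  by (cases k) (auto intro!: continuous_at_imp_continuous_on differentiable_imp_continuous_within)

lemma smooth_on_extension:
  assumes "smooth_on S f"
  obtains W g where "open W" "S \<subseteq> W" "\<And>k. Ck_on k W g" "\<And>x. x \<in> S \<Longrightarrow> g x = f x"
  using assms unfolding smooth_on_def by blast

lemma Ck_on_subset: "Ck_on k S f \<Longrightarrow> S' \<subseteq> S \<Longrightarrow> Ck_on k S' f"
proof (induction k arbitrary: f)
  case 0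
  thus ?case by (simp add: continuous_on_subset)
next
  case (Suc k)
  show ?case unfolding Ck_on.simps
    using Suc.prems Suc.IH by (metis Ck_on.simps(2) subsetD)
qed

lemma frechet_derivative_cong_open:
  assumes "open S" "x \<in> S" "\<And>y. y \<in> S \<Longrightarrow> f y = g y" "g differentiable at x"
  shows "f differentiable at x" "frechet_derivative f (at x) = frechet_derivative g (at x)"
proof -
  have "(g has_derivative frechet_derivative g (at x)) (at x)"
    using assms(4) by (simp add: frechet_derivative_works)
  hence "(f has_derivative frechet_derivative g (at x)) (at x)"
    by (rule has_derivative_transform_within_open[OF _ assms(1,2)]) (simp add: assms(3))
  thus "f differentiable at x" "frechet_derivative f (at x) = frechet_derivative g (at x)"
    using frechet_derivative_at differentiable_def by (blast, metis)
qed

text \<open>Passes smoothness from an extension back to the given function: on an open set the two have the same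
derivatives.\<close>

lemma Ck_on_cong:
  assumes "open S" "Ck_on k S g" "\<And>x. x \<in> S \<Longrightarrow> f x = g x"
  shows "Ck_on k S f"
  using assms(2,3)
proof (induction k arbitrary: f g)
  case 0
  thus ?case using continuous_on_cong by (metis Ck_on.simps(1))
next
  case (Suc k)
  have d: "g differentiable at x" if "x \<in> S" for x using Suc.prems(1) that by simp
  note cong = frechet_derivative_cong_open[OF assms(1) _ Suc.prems(2) d]
  have "Ck_on k S (dir_deriv v f)" for v
    by (rule Suc.IH[of "dir_deriv v g"]) (use Suc.prems(1) cong(2) in auto)
  thus ?case using cong(1) by simp
qed

lemma smooth_on_open_imp_Ck_on:
  assumes "open S" "smooth_on S f"
  shows "Ck_on k S f"
proof -
  obtain W g where "S \<subseteq> W" "Ck_on k W g" "\<And>x. x \<in> S \<Longrightarrow> g x = f x"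
    using smooth_on_extension[OF assms(2)] by metis
  thus ?thesis using Ck_on_cong[OF assms(1) Ck_on_subset] by metis
qed

lemma dir_deriv_linear:
  assumes "f differentiable at x"
  shows "linear (\<lambda>v. dir_deriv v f x)"
  using linear_frechet_derivative[OF assms] .

lemma dir_deriv_Basis_expansion:
  fixes f :: "'a::euclidean_space \<Rightarrow> 'b::real_normed_vector"
  assumes "f differentiable at x"
  shows "dir_deriv v f x = (\<Sum>b\<in>Basis. (v \<bullet> b) *\<^sub>R dir_deriv b f x)"
proof -
  interpret linear "\<lambda>v. dir_deriv v f x" by (rule dir_deriv_linear[OF assms])
  have "dir_deriv v f x = dir_deriv (\<Sum>b\<in>Basis. (v \<bullet> b) *\<^sub>R b) f x"
    by (simp add: euclidean_representation)
  also have "\<dots> = (\<Sum>b\<in>Basis. (v \<bullet> b) *\<^sub>R dir_deriv b f x)"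
    by (simp add: sum scaleR)
  finally show ?thesis .
qed

text \<open>The continuity of each directional derivative is all that the class C1 provides; in finite dimension
this gives a bound uniform over all directions by expanding the direction in the basis.\<close>

lemma C1_dir_deriv_bounded:
  fixes f :: "'a::euclidean_space \<Rightarrow> 'b::real_normed_vector"
  assumes f: "Ck_on (Suc 0) W f" and K: "compact K" "K \<subseteq> W"
  shows "\<exists>B\<ge>0. \<forall>x\<in>K. \<forall>v. norm (dir_deriv v f x) \<le> B * norm v"
proof -
  have "\<exists>C. \<forall>b. C b \<ge> 0 \<and> (\<forall>x\<in>K. norm (dir_deriv b f x) \<le> C b)"
  proof (intro choice allI)
    fix b
    have "continuous_on K (dir_deriv b f)"
      by (rule continuous_on_subset[OF Ck_on_continuous[OF Ck_on_dir_deriv[OF f]] K(2)])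
    hence "bounded (dir_deriv b f ` K)"
      using K(1) compact_continuous_image compact_imp_bounded by blast
    then obtain c where "\<forall>x\<in>K. norm (dir_deriv b f x) \<le> c"
      unfolding bounded_iff by blast
    thus "\<exists>c. c \<ge> 0 \<and> (\<forall>x\<in>K. norm (dir_deriv b f x) \<le> c)"
      by (intro exI[of _ "max 0 c"]) auto
  qed
  then obtain C where C: "\<And>b. C b \<ge> 0" "\<And>b x. x \<in> K \<Longrightarrow> norm (dir_deriv b f x) \<le> C b" by blast
  show ?thesis
  proof (intro exI[of _ "\<Sum>b\<in>Basis. C b"] conjI ballI allI)
    show "(\<Sum>b\<in>Basis. C b) \<ge> 0" using C(1) by (simp add: sum_nonneg)
    fix x v assume x: "x \<in> K"
    have "f differentiable at x" using f x K by auto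
    hence "norm (dir_deriv v f x) = norm (\<Sum>b\<in>Basis. (v \<bullet> b) *\<^sub>R dir_deriv b f x)"
      using dir_deriv_Basis_expansion by metis
    also have "\<dots> \<le> (\<Sum>b\<in>Basis. norm ((v \<bullet> b) *\<^sub>R dir_deriv b f x))" by (rule norm_sum)
    also have "\<dots> \<le> (\<Sum>b\<in>Basis. norm v * C b)"
      by (intro sum_mono) (auto intro!: mult_mono C x Basis_le_norm)
    also have "\<dots> = (\<Sum>b\<in>Basis. C b) * norm v" by (simp add: sum_distrib_left mult.commute)
    finally show "norm (dir_deriv v f x) \<le> (\<Sum>b\<in>Basis. C b) * norm v" .
  qed
qed

lemma segment_mean_value:
  fixes f :: "'a::real_normed_vector \<Rightarrow> 'b::real_normed_vector"
  assumes diff: "\<And>z. z \<in> closed_segment x y \<Longrightarrow> f differentiable at z"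
    and bound: "\<And>z v. z \<in> closed_segment x y \<Longrightarrow> norm (dir_deriv v f z) \<le> B * norm v"
    and "0 \<le> B"
  shows "norm (f x - f y) \<le> B * norm (x - y)"
proof (rule differentiable_bound[where S="closed_segment x y" and f'="\<lambda>z v. dir_deriv v f z"])
  fix z assume z: "z \<in> closed_segment x y"
  show "(f has_derivative (\<lambda>v. dir_deriv v f z)) (at z within closed_segment x y)"
    using diff[OF z] by (simp add: frechet_derivative_works has_derivative_at_withinI)
  show "onorm (\<lambda>v. dir_deriv v f z) \<le> B"
    by (rule onorm_bound) (use \<open>0 \<le> B\<close> bound[OF z] in auto)
qed auto

text \<open>A tube around a curve in space-time is in general not convex, so the mean value inequality is used on those segments
that lie in \<open>K\<close>.\<close>

lemma C2_dir_deriv_lipschitz: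
  fixes f :: "'a::euclidean_space \<Rightarrow> 'b::real_normed_vector"
  assumes f: "Ck_on (Suc (Suc 0)) W f" and K: "compact K" "K \<subseteq> W"
  shows "\<exists>B\<ge>0. \<forall>x y v. closed_segment x y \<subseteq> K \<longrightarrow>
           norm (dir_deriv v f x - dir_deriv v f y) \<le> B * norm (x - y) * norm v"
proof -
  have "\<exists>C. \<forall>b. C b \<ge> 0 \<and> (\<forall>x\<in>K. \<forall>v. norm (dir_deriv v (dir_deriv b f) x) \<le> C b * norm v)"
    by (intro choice allI C1_dir_deriv_bounded[OF Ck_on_dir_deriv[OF f] K])
  then obtain C where C: "\<And>b. C b \<ge> 0"
    "\<And>b x v. x \<in> K \<Longrightarrow> norm (dir_deriv v (dir_deriv b f) x) \<le> C b * norm v" by blast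
  show ?thesis
  proof (intro exI[of _ "\<Sum>b\<in>Basis. C b"] conjI impI allI)
    show "(\<Sum>b\<in>Basis. C b) \<ge> 0" using C(1) by (simp add: sum_nonneg)
    fix x y v assume seg: "closed_segment x y \<subseteq> K"
    have d: "f differentiable at x" "f differentiable at y" using f seg K by auto
    have lip: "norm (dir_deriv b f x - dir_deriv b f y) \<le> C b * norm (x - y)" for b
    proof (rule segment_mean_value)
      fix z assume z: "z \<in> closed_segment x y"
      show "dir_deriv b f differentiable at z" using f seg K z by auto
      show "norm (dir_deriv v (dir_deriv b f) z) \<le> C b * norm v" for v using C(2) seg z by blast
    qed (rule C(1))
    have "norm (dir_deriv v f x - dir_deriv v f y)
        = norm (\<Sum>b\<in>Basis. (v \<bullet> b) *\<^sub>R (dir_deriv b f x - dir_deriv b f y))"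
      using dir_deriv_Basis_expansion[OF d(1), of v] dir_deriv_Basis_expansion[OF d(2), of v]
      by (simp add: scaleR_diff_right sum_subtractf)
    also have "\<dots> \<le> (\<Sum>b\<in>Basis. norm ((v \<bullet> b) *\<^sub>R (dir_deriv b f x - dir_deriv b f y)))" by (rule norm_sum)
    also have "\<dots> \<le> (\<Sum>b\<in>Basis. norm v * (C b * norm (x - y)))"
      unfolding norm_scaleR by (intro sum_mono mult_mono) (auto intro!: lip Basis_le_norm)
    also have "\<dots> = (\<Sum>b\<in>Basis. C b) * norm (x - y) * norm v"
      by (simp add: sum_distrib_left sum_distrib_right algebra_simps)
    finally show "norm (dir_deriv v f x - dir_deriv v f y) \<le> (\<Sum>b\<in>Basis. C b) * norm (x - y) * norm v" .
  qed
qed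

text \<open>The mean value inequality for \<open>f\<close> minus its linear part at \<open>x\<close>, whose derivative is small of first order
along the segment because the derivative of \<open>f\<close> is Lipschitz.\<close>

lemma C2_taylor:
  fixes f :: "'a::euclidean_space \<Rightarrow> 'b::real_normed_vector"
  assumes f: "Ck_on (Suc (Suc 0)) W f" and K: "compact K" "K \<subseteq> W"
  shows "\<exists>B\<ge>0. \<forall>x y. closed_segment x y \<subseteq> K \<longrightarrow>
           norm (f y - f x - dir_deriv (y - x) f x) \<le> B * (norm (y - x))\<^sup>2"
proof -
  obtain B where B: "B \<ge> 0" "\<And>x y v. closed_segment x y \<subseteq> K \<Longrightarrow>
           norm (dir_deriv v f x - dir_deriv v f y) \<le> B * norm (x - y) * norm v"
    using C2_dir_deriv_lipschitz[OF assms] by blast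
  have "norm (f y - f x - dir_deriv (y - x) f x) \<le> B * (norm (y - x))\<^sup>2"
    if seg: "closed_segment x y \<subseteq> K" for x y
  proof -
    have dx: "f differentiable at x" using f seg K by auto
    let ?h = "\<lambda>z. f z - dir_deriv z f x"
    interpret lin: bounded_linear "\<lambda>v. dir_deriv v f x"
      by (rule has_derivative_bounded_linear[OF dx[unfolded frechet_derivative_works]])
    have h: "(?h has_derivative (\<lambda>v. dir_deriv v f z - dir_deriv v f x)) (at z)"
      if z: "z \<in> closed_segment x y" for z
    proof (rule has_derivative_diff)
      show "(f has_derivative (\<lambda>v. dir_deriv v f z)) (at z)"
        by (rule Ck_on_has_derivative[OF f]) (use z seg K in blast)
      show "((\<lambda>z. dir_deriv z f x) has_derivative (\<lambda>v. dir_deriv v f x)) (at z)"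
        by (rule lin.has_derivative) (rule has_derivative_ident)
    qed
    have "norm (?h y - ?h x) \<le> (B * norm (y - x)) * norm (y - x)"
    proof (rule segment_mean_value)
      fix z v assume "z \<in> closed_segment y x"
      hence z: "z \<in> closed_segment x y" by (simp only: closed_segment_commute)
      show "?h differentiable at z" using h[OF z] differentiable_def by blast
      have "closed_segment z x \<subseteq> K"
        using z seg subset_closed_segment[of z x x y] by blast
      hence "norm (dir_deriv v f z - dir_deriv v f x) \<le> B * norm (z - x) * norm v" by (rule B)
      also have "\<dots> \<le> B * norm (y - x) * norm v"
        using B(1) segment_bound(1)[OF z] by (intro mult_right_mono mult_left_mono) auto
      finally show "norm (dir_deriv v ?h z) \<le> B * norm (y - x) * norm v"
        by (simp add: frechet_derivative_at[OF h[OF z], symmetric])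
    qed (use B(1) in auto)
    moreover have "?h y - ?h x = f y - f x - dir_deriv (y - x) f x"
      by (simp add: lin.diff)
    ultimately show ?thesis by (simp add: power2_eq_square mult.assoc)
  qed
  with B(1) show ?thesis by blast
qed

text \<open>Schwarz's theorem. The second difference of \<open>f\<close> over a small parallelogram is, by applying the mean
value theorem once in each direction, a multiple of a second derivative at some nearby point; the
order in which the directions are taken decides which of the two mixed derivatives appears, and
continuity makes both close to their values at \<open>x\<close>.\<close>

lemma dir_deriv_symmetric_real:
  fixes f :: "'a::real_normed_vector \<Rightarrow> real"
  assumes W: "open W" "x \<in> W"
    and f': "\<And>y. y \<in> W \<Longrightarrow> (f has_derivative f' y) (at y)"
    and fv: "\<And>y. y \<in> W \<Longrightarrow> ((\<lambda>y. f' y v) has_derivative fv y) (at y)"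
    and fw: "\<And>y. y \<in> W \<Longrightarrow> ((\<lambda>y. f' y w) has_derivative fw y) (at y)"
    and cv: "isCont (\<lambda>y. fv y w) x" and cw: "isCont (\<lambda>y. fw y v) x"
  shows "fv x w = fw x v"
proof (rule ccontr)
  assume ne: "fv x w \<noteq> fw x v"
  define e where "e = \<bar>fv x w - fw x v\<bar> / 2"
  have e: "e > 0" using ne by (simp add: e_def)
  obtain r where r: "r > 0" "ball x r \<subseteq> W" using W openE by blast
  obtain r1 where r1: "r1 > 0" "\<And>y. dist y x < r1 \<Longrightarrow> dist (fv y w) (fv x w) < e"
    using cv e unfolding continuous_at_eps_delta by blast
  obtain r2 where r2: "r2 > 0" "\<And>y. dist y x < r2 \<Longrightarrow> dist (fw y v) (fw x v) < e"
    using cw e unfolding continuous_at_eps_delta by blast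
  define d where "d = min r (min r1 r2)"
  have d: "d > 0" "d \<le> r" "d \<le> r1" "d \<le> r2" using r r1 r2 by (auto simp: d_def)
  define h where "h = d / (2 * (norm v + norm w + 1))"
  have h: "h > 0" using d by (simp add: h_def add_nonneg_pos)
  have hd: "h * (norm v + norm w) < d"
  proof -
    have "h * (norm v + norm w) \<le> h * (norm v + norm w + 1)" using h by simp
    also have "\<dots> = d / 2"
    proof -
      have "norm v + norm w + 1 \<noteq> 0" using norm_ge_zero[of v] norm_ge_zero[of w] by linarith
      thus ?thesis unfolding h_def by (simp add: field_simps)
    qed
    finally show ?thesis using d by simp
  qed
  have near: "dist (x + s *\<^sub>R v + t *\<^sub>R w) x < d" if "0 \<le> s" "s \<le> h" "0 \<le> t" "t \<le> h" for s t
  proof -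
    have "dist (x + s *\<^sub>R v + t *\<^sub>R w) x = norm (s *\<^sub>R v + t *\<^sub>R w)"
      by (simp add: dist_norm add.assoc)
    also have "\<dots> \<le> s * norm v + t * norm w" using that norm_triangle_ineq[of "s *\<^sub>R v" "t *\<^sub>R w"] by simp
    also have "\<dots> \<le> h * (norm v + norm w)" using that by (simp add: distrib_left add_mono mult_right_mono)
    finally show ?thesis using hd by simp
  qed
  have inW: "x + s *\<^sub>R v + t *\<^sub>R w \<in> W" if "0 \<le> s" "s \<le> h" "0 \<le> t" "t \<le> h" for s t
    using near[OF that] r d by (auto simp: dist_commute subset_iff)
  \<comment> \<open>The double difference over a small parallelogram, evaluated in the two possible orders.\<close>
  define \<Delta> where "\<Delta> = f (x + h *\<^sub>R v + h *\<^sub>R w) - f (x + h *\<^sub>R v) - f (x + h *\<^sub>R w) + f x"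
  have "\<exists>s\<in>{0<..<h}. (f (x + h *\<^sub>R v + h *\<^sub>R w) - f (x + h *\<^sub>R v + 0 *\<^sub>R w))
      - (f (x + 0 *\<^sub>R v + h *\<^sub>R w) - f (x + 0 *\<^sub>R v + 0 *\<^sub>R w))
      = f' (x + s *\<^sub>R v + h *\<^sub>R w) ((h - 0) *\<^sub>R v) - f' (x + s *\<^sub>R v + 0 *\<^sub>R w) ((h - 0) *\<^sub>R v)"
    apply (rule mvt_simple[OF h, where f="\<lambda>s. f (x + s *\<^sub>R v + h *\<^sub>R w) - f (x + s *\<^sub>R v + 0 *\<^sub>R w)"])
    apply (rule has_derivative_at_withinI)
    using h
    by (intro has_derivative_diff has_derivative_compose[OF _ f'] inW) (auto intro!: derivative_eq_intros)
  then obtain s where s: "s \<in> {0<..<h}"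
    "\<Delta> = f' (x + s *\<^sub>R v + h *\<^sub>R w) (h *\<^sub>R v) - f' (x + s *\<^sub>R v + 0 *\<^sub>R w) (h *\<^sub>R v)"
    unfolding \<Delta>_def by auto
  have lin: "f' y (c *\<^sub>R z) = c * f' y z" if "y \<in> W" for y c z
    using has_derivative_linear[OF f'[OF that]] by (simp add: linear_scale)
  have "\<exists>t\<in>{0<..<h}. f' (x + s *\<^sub>R v + h *\<^sub>R w) v - f' (x + s *\<^sub>R v + 0 *\<^sub>R w) v
       = fv (x + s *\<^sub>R v + t *\<^sub>R w) ((h - 0) *\<^sub>R w)"
    apply (rule mvt_simple[OF h, where f="\<lambda>t. f' (x + s *\<^sub>R v + t *\<^sub>R w) v"])
    apply (rule has_derivative_at_withinI)
    using h s(1)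
    by (intro has_derivative_compose[OF _ fv] inW) (auto intro!: derivative_eq_intros)
  then obtain t where t: "t \<in> {0<..<h}"
    "f' (x + s *\<^sub>R v + h *\<^sub>R w) v - f' (x + s *\<^sub>R v + 0 *\<^sub>R w) v = fv (x + s *\<^sub>R v + t *\<^sub>R w) (h *\<^sub>R w)"
    by auto
  have 1: "\<Delta> = h * (h * fv (x + s *\<^sub>R v + t *\<^sub>R w) w)"
  proof -
    have "\<Delta> = h * (f' (x + s *\<^sub>R v + h *\<^sub>R w) v - f' (x + s *\<^sub>R v + 0 *\<^sub>R w) v)"
      using s h lin[OF inW[of s h], of h v] lin[OF inW[of s 0], of h v]
      by (simp add: right_diff_distrib)
    also have "\<dots> = h * (h * fv (x + s *\<^sub>R v + t *\<^sub>R w) w)"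
      using has_derivative_linear[OF fv[OF inW[of s t]]] s t h
      by (simp only: t(2)) (simp add: linear_scale)
    finally show ?thesis .
  qed
  have "\<exists>s\<in>{0<..<h}. (f (x + h *\<^sub>R v + h *\<^sub>R w) - f (x + 0 *\<^sub>R v + h *\<^sub>R w))
      - (f (x + h *\<^sub>R v + 0 *\<^sub>R w) - f (x + 0 *\<^sub>R v + 0 *\<^sub>R w))
      = f' (x + h *\<^sub>R v + s *\<^sub>R w) ((h - 0) *\<^sub>R w) - f' (x + 0 *\<^sub>R v + s *\<^sub>R w) ((h - 0) *\<^sub>R w)"
    apply (rule mvt_simple[OF h, where f="\<lambda>s. f (x + h *\<^sub>R v + s *\<^sub>R w) - f (x + 0 *\<^sub>R v + s *\<^sub>R w)"])
    apply (rule has_derivative_at_withinI)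
    using h
    by (intro has_derivative_diff has_derivative_compose[OF _ f'] inW) (auto intro!: derivative_eq_intros)
  then obtain s' where s': "s' \<in> {0<..<h}"
    "\<Delta> = f' (x + h *\<^sub>R v + s' *\<^sub>R w) (h *\<^sub>R w) - f' (x + 0 *\<^sub>R v + s' *\<^sub>R w) (h *\<^sub>R w)"
    unfolding \<Delta>_def by auto
  have "\<exists>t\<in>{0<..<h}. f' (x + h *\<^sub>R v + s' *\<^sub>R w) w - f' (x + 0 *\<^sub>R v + s' *\<^sub>R w) w
       = fw (x + t *\<^sub>R v + s' *\<^sub>R w) ((h - 0) *\<^sub>R v)"
    apply (rule mvt_simple[OF h, where f="\<lambda>t. f' (x + t *\<^sub>R v + s' *\<^sub>R w) w"])
    apply (rule has_derivative_at_withinI)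
    using h s'(1)
    by (intro has_derivative_compose[OF _ fw] inW) (auto intro!: derivative_eq_intros)
  then obtain t' where t': "t' \<in> {0<..<h}"
    "f' (x + h *\<^sub>R v + s' *\<^sub>R w) w - f' (x + 0 *\<^sub>R v + s' *\<^sub>R w) w = fw (x + t' *\<^sub>R v + s' *\<^sub>R w) (h *\<^sub>R v)"
    by auto
  have 2: "\<Delta> = h * (h * fw (x + t' *\<^sub>R v + s' *\<^sub>R w) v)"
  proof -
    have "\<Delta> = h * (f' (x + h *\<^sub>R v + s' *\<^sub>R w) w - f' (x + 0 *\<^sub>R v + s' *\<^sub>R w) w)"
      using s' h lin[OF inW[of h s'], of h w] lin[OF inW[of 0 s'], of h w]
      by (simp add: right_diff_distrib)
    also have "\<dots> = h * (h * fw (x + t' *\<^sub>R v + s' *\<^sub>R w) v)"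
      using has_derivative_linear[OF fw[OF inW[of t' s']]] s' t' h
      by (simp only: t'(2)) (simp add: linear_scale)
    finally show ?thesis .
  qed
  have "dist (fv (x + s *\<^sub>R v + t *\<^sub>R w) w) (fv x w) < e"
    using near[of s t] s t d by (intro r1(2)) auto
  moreover have "dist (fw (x + t' *\<^sub>R v + s' *\<^sub>R w) v) (fw x v) < e"
    using near[of t' s'] s' t' d by (intro r2(2)) auto
  moreover have "fv (x + s *\<^sub>R v + t *\<^sub>R w) w = fw (x + t' *\<^sub>R v + s' *\<^sub>R w) v"
    using 1 2 h by simp
  ultimately show False unfolding e_def dist_real_def by (simp add: abs_if field_simps split: if_splits)
qed

lemma C2_dir_deriv_symmetric:
  fixes f :: "'a::real_normed_vector \<Rightarrow> 'b::real_inner"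
  assumes W: "open W" "x \<in> W" and f: "Ck_on (Suc (Suc 0)) W f"
  shows "dir_deriv v (dir_deriv w f) x = dir_deriv w (dir_deriv v f) x"
proof -
  have "dir_deriv v (dir_deriv w f) x \<bullet> c = dir_deriv w (dir_deriv v f) x \<bullet> c" for c
  proof (rule dir_deriv_symmetric_real[OF W, where f="\<lambda>y. f y \<bullet> c" and f'="\<lambda>y v. dir_deriv v f y \<bullet> c"
      and fv="\<lambda>y v. dir_deriv v (dir_deriv w f) y \<bullet> c" and fw="\<lambda>y w. dir_deriv w (dir_deriv v f) y \<bullet> c"])
    fix y assume y: "y \<in> W"
    show "((\<lambda>y. f y \<bullet> c) has_derivative (\<lambda>v. dir_deriv v f y \<bullet> c)) (at y)"
      by (intro has_derivative_inner_left Ck_on_has_derivative[OF f y])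
    show "((\<lambda>y. dir_deriv w f y \<bullet> c) has_derivative (\<lambda>v. dir_deriv v (dir_deriv w f) y \<bullet> c)) (at y)"
         "((\<lambda>y. dir_deriv v f y \<bullet> c) has_derivative (\<lambda>w. dir_deriv w (dir_deriv v f) y \<bullet> c)) (at y)"
      by (intro has_derivative_inner_left Ck_on_has_derivative[OF Ck_on_dir_deriv[OF f] y])+
  next
    have "isCont (dir_deriv v (dir_deriv w f)) x" for v w
      using Ck_on_continuous[OF Ck_on_dir_deriv[OF Ck_on_dir_deriv[OF f]]] W
      by (simp add: continuous_on_eq_continuous_at)
    thus "isCont (\<lambda>y. dir_deriv v (dir_deriv w f) y \<bullet> c) x"
      "isCont (\<lambda>y. dir_deriv w (dir_deriv v f) y \<bullet> c) x"
      by (auto intro!: continuous_intros)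
  qed
  thus ?thesis by (metis vector_eq_rdot)
qed

section \<open>A Gronwall estimate\<close>

text \<open>The constant is not the sharp one. Working with \<open>\<parallel>z\<parallel>\<^sup>2\<close> instead of \<open>\<parallel>z\<parallel>\<close> avoids the points where the norm is
not differentiable, at the price of replacing \<open>L\<close> by \<open>L + 1\<close> when the mixed term \<open>2 \<parallel>z\<parallel> \<epsilon>\<close> is absorbed.\<close>

lemma norm_gronwall:
  fixes z :: "real \<Rightarrow> 'a::real_inner"
  assumes deriv: "\<And>s. s \<in> {0..T} \<Longrightarrow> (z has_vector_derivative z' s) (at s within {0..T})"
    and bound: "\<And>s. s \<in> {0..T} \<Longrightarrow> norm (z' s) \<le> L * norm (z s) + \<epsilon>"
    and "0 \<le> L" "0 \<le> \<epsilon>" and t: "t \<in> {0..T}"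
  shows "norm (z t) \<le> exp ((L + 1) * T) * (norm (z 0) + \<epsilon>)"
proof -
  \<comment> \<open>This exponent is the one for the squared norm.\<close>
  define m where "m = 2 * (L + 1)"
  define p where "p s = exp (- m * s) * (z s \<bullet> z s + \<epsilon>\<^sup>2)" for s
  have p: "(p has_real_derivative exp (- m * s) * (2 * (z s \<bullet> z' s) - m * (z s \<bullet> z s + \<epsilon>\<^sup>2))) (at s within {0..T})"
    if "s \<in> {0..T}" for s
  proof -
    have "((\<lambda>s. z s \<bullet> z s) has_vector_derivative z s \<bullet> z' s + z' s \<bullet> z s) (at s within {0..T})"
      by (rule bounded_bilinear.has_vector_derivative[OF bounded_bilinear_inner]) (use deriv that in auto)
    hence [derivative_intros]: "((\<lambda>s. z s \<bullet> z s) has_real_derivative 2 * (z s \<bullet> z' s)) (at s within {0..T})"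
      by (simp add: has_real_derivative_iff_has_vector_derivative inner_commute)
    show ?thesis unfolding p_def
      by (auto intro!: derivative_eq_intros simp: algebra_simps)
  qed
  have "p t \<le> p 0"
  proof (rule DERIV_nonpos_imp_decreasing_open[where f=p])
    show "0 \<le> t" using t by simp
    show "continuous_on {0..t} p"
      by (rule continuous_on_subset[OF DERIV_continuous_on[OF p]]) (use t in auto)
    fix s assume s: "0 < s" "s < t"
    hence sT: "s \<in> {0..T}" using t by auto
    have at: "at s within {0..T} = at s" using s t by (intro at_within_Icc_at) auto
    have "z s \<bullet> z' s \<le> norm (z s) * norm (z' s)" by (rule norm_cauchy_schwarz)
    also have "\<dots> \<le> norm (z s) * (L * norm (z s) + \<epsilon>)" by (intro mult_left_mono bound sT) auto
    finally have "2 * (z s \<bullet> z' s) \<le> 2 * L * (norm (z s))\<^sup>2 + 2 * norm (z s) * \<epsilon>"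
      by (simp add: power2_eq_square algebra_simps)
    moreover have "2 * norm (z s) * \<epsilon> \<le> (norm (z s))\<^sup>2 + \<epsilon>\<^sup>2" using sum_squares_bound by blast
    moreover have "0 \<le> L * \<epsilon>\<^sup>2" "0 \<le> (norm (z s))\<^sup>2" "0 \<le> \<epsilon>\<^sup>2" using \<open>0 \<le> L\<close> by auto
    moreover have "m * (z s \<bullet> z s + \<epsilon>\<^sup>2) = 2 * L * (norm (z s))\<^sup>2 + 2 * (L * \<epsilon>\<^sup>2) + 2 * (norm (z s))\<^sup>2 + 2 * \<epsilon>\<^sup>2"
      unfolding m_def power2_norm_eq_inner[symmetric] by (simp add: algebra_simps)
    ultimately have "2 * (z s \<bullet> z' s) - m * (z s \<bullet> z s + \<epsilon>\<^sup>2) \<le> 0" by linarith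
    thus "\<exists>y. DERIV p s :> y \<and> y \<le> 0"
      using p[OF sT] unfolding at by (meson exp_ge_zero mult_nonneg_nonpos)
  qed
  hence "exp (- (m * t)) * ((norm (z t))\<^sup>2 + \<epsilon>\<^sup>2) \<le> (norm (z 0))\<^sup>2 + \<epsilon>\<^sup>2"
    by (simp add: p_def power2_norm_eq_inner)
  hence "(norm (z t))\<^sup>2 + \<epsilon>\<^sup>2 \<le> exp (m * t) * ((norm (z 0))\<^sup>2 + \<epsilon>\<^sup>2)"
    by (simp add: exp_minus field_simps)
  also have "\<dots> \<le> exp (m * T) * (norm (z 0) + \<epsilon>)\<^sup>2"
    using t \<open>0 \<le> L\<close> \<open>0 \<le> \<epsilon>\<close> by (intro mult_mono) (auto simp: m_def power2_sum intro!: mult_left_mono)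
  also have "\<dots> = (exp ((L + 1) * T) * (norm (z 0) + \<epsilon>))\<^sup>2"
    by (simp add: m_def power_mult_distrib exp_double[symmetric] mult.assoc)
  finally have "(norm (z t))\<^sup>2 \<le> (exp ((L + 1) * T) * (norm (z 0) + \<epsilon>))\<^sup>2"
    using zero_le_power2[of \<epsilon>] by linarith
  thus ?thesis by (rule power2_le_imp_le) (use \<open>0 \<le> \<epsilon>\<close> in simp)
qed

text \<open>The growth bound is known only as long as \<open>z\<close> is in the ball of radius \<open>r\<close>. At a first time where the norm equals \<open>r\<close>
the Gronwall estimate on the interval before it already gives a value below \<open>r\<close>, so \<open>z\<close> never gets there.\<close>

lemma norm_gronwall_bootstrap:
  fixes z :: "real \<Rightarrow> 'a::real_inner"
  assumes deriv: "\<And>s. s \<in> {0..T} \<Longrightarrow> (z has_vector_derivative z' s) (at s within {0..T})"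
    and bound: "\<And>s. s \<in> {0..T} \<Longrightarrow> norm (z s) \<le> r \<Longrightarrow> norm (z' s) \<le> L * norm (z s)"
    and L: "0 \<le> L" and small: "exp ((L + 1) * T) * norm (z 0) < r" and t: "t \<in> {0..T}"
  shows "norm (z t) \<le> exp ((L + 1) * T) * norm (z 0)" and "norm (z t) < r"
proof -
  have T: "0 \<le> T" using t by simp
  have "1 * norm (z 0) \<le> exp ((L + 1) * T) * norm (z 0)"
    using L T by (intro mult_right_mono) auto
  hence z0: "norm (z 0) < r" using small by simp
  have cont: "continuous_on {0..T} (\<lambda>s. norm (z s))"
    using deriv has_vector_derivative_continuous continuous_on_eq_continuous_within
    by (intro continuous_on_norm) blast
  have inside: "norm (z s) < r" if s: "s \<in> {0..T}" for s
  proof (rule ccontr)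
    assume "\<not> norm (z s) < r"
    define S where "S = {x \<in> {0..T}. norm (z x) = r}"
    have hit: "\<exists>x. 0 \<le> x \<and> x \<le> y \<and> norm (z x) = r" if "y \<in> {0..T}" "r \<le> norm (z y)" for y
      by (rule IVT') (use that z0 in \<open>auto intro: continuous_on_subset[OF cont]\<close>)
    obtain x where "0 \<le> x" "x \<le> s" "norm (z x) = r"
      using hit[OF s] \<open>\<not> norm (z s) < r\<close> by auto
    hence "x \<in> S" using s by (simp add: S_def)
    hence "S \<noteq> {}" by blast
    moreover have "compact S"
    proof -
      have "closed ({0..T} \<inter> (\<lambda>s. norm (z s)) -` {r})"
        by (rule continuous_closed_preimage[OF cont]) auto
      hence "compact ({0..T} \<inter> ({0..T} \<inter> (\<lambda>s. norm (z s)) -` {r}))"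
        by (rule compact_Int_closed[OF compact_Icc])
      moreover have "{0..T} \<inter> ({0..T} \<inter> (\<lambda>s. norm (z s)) -` {r}) = S"
        unfolding S_def by blast
      ultimately show ?thesis by simp
    qed
    ultimately obtain t0 where t0: "t0 \<in> S" "\<And>x. x \<in> S \<Longrightarrow> t0 \<le> x"
      using compact_attains_inf[of S] by metis
    have t0T: "t0 \<in> {0..T}" "norm (z t0) = r" using t0 by (auto simp: S_def)
    have below: "norm (z x) \<le> r" if x: "x \<in> {0..t0}" for x
    proof (rule ccontr)
      assume *: "\<not> norm (z x) \<le> r"
      obtain y where y: "0 \<le> y" "y \<le> x" "norm (z y) = r" using hit[of x] x t0T * by auto
      hence "t0 \<le> y" using x t0T by (intro t0(2)) (auto simp: S_def)
      hence "x = y" using x y by auto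
      thus False using y * by simp
    qed
    have "norm (z t0) \<le> exp ((L + 1) * t0) * (norm (z 0) + 0)"
    proof (rule norm_gronwall[where z'=z'])
      fix x assume x: "x \<in> {0..t0}"
      hence xT: "x \<in> {0..T}" using t0T by simp
      show "(z has_vector_derivative z' x) (at x within {0..t0})"
        by (rule has_vector_derivative_within_subset[OF deriv[OF xT]]) (use t0T in auto)
      show "norm (z' x) \<le> L * norm (z x) + 0" using bound[OF xT below[OF x]] by simp
    qed (use L t0T in auto)
    also have "\<dots> \<le> exp ((L + 1) * T) * norm (z 0)"
      using t0T L by (auto intro!: mult_right_mono mult_left_mono)
    finally show False using small t0T by simp
  qed
  show "norm (z t) < r" by (rule inside[OF t])
  have "norm (z t) \<le> exp ((L + 1) * T) * (norm (z 0) + 0)"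
    by (rule norm_gronwall[where z'=z'])
      (use t L inside in \<open>simp_all add: deriv bound less_imp_le\<close>)
  thus "norm (z t) \<le> exp ((L + 1) * T) * norm (z 0)" by simp
qed

section \<open>Differentiability of a flow in its initial position\<close>

text \<open>Differentiability without a candidate for the derivative. The difference quotients along the basis
vectors approximate \<open>f\<close> linearly with quadratic error; taking \<open>v\<close> itself as a small multiple of a basis
vector shows that they form a Cauchy sequence as \<open>h\<close> tends to zero, and their limits are the partial
derivatives.\<close>

lemma differentiable_of_approximate_linearity:
  fixes f :: "'a::euclidean_space \<Rightarrow> 'b::banach"
  assumes \<delta>: "\<delta> > 0" and C: "0 \<le> C" and f0: "f 0 = 0"
    and approx: "\<And>v h. norm v < \<delta> \<Longrightarrow> 0 < h \<Longrightarrow> h < \<delta> \<Longrightarrow>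
      norm (f v - (\<Sum>b\<in>Basis. (v \<bullet> b) *\<^sub>R (f (h *\<^sub>R b) /\<^sub>R h))) \<le> C * ((norm v)\<^sup>2 + norm v * h)"
  shows "f differentiable at 0"
proof -
  define h where "h n = \<delta> / real (n + 2)" for n
  have h: "0 < h n" "h n < \<delta>" for n using \<delta> by (auto simp: h_def divide_less_eq)
  have h0: "h \<longlonglongrightarrow> 0" unfolding h_def
    using LIMSEQ_ignore_initial_segment[OF lim_const_over_n[of \<delta>], of 2] by simp
  define q where "q b n = f (h n *\<^sub>R b) /\<^sub>R h n" for b n
  have q: "norm (q b m - q b n) \<le> C * (h m + h n)" if b: "b \<in> Basis" for b m n
  proof -
    have "(\<Sum>c\<in>Basis. ((h m *\<^sub>R b) \<bullet> c) *\<^sub>R (f (h n *\<^sub>R c) /\<^sub>R h n)) = h m *\<^sub>R q b n"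
      using b by (subst sum.remove[of _ b]) (auto simp: q_def inner_Basis split: if_splits intro!: sum.neutral)
    hence "norm (f (h m *\<^sub>R b) - h m *\<^sub>R q b n) \<le> C * ((h m)\<^sup>2 + h m * h n)"
      using approx[of "h m *\<^sub>R b" "h n"] h[of m] h[of n] b by simp
    moreover have "f (h m *\<^sub>R b) - h m *\<^sub>R q b n = h m *\<^sub>R (q b m - q b n)"
      using h[of m] by (simp add: q_def[of b m] scaleR_diff_right)
    ultimately have "h m * norm (q b m - q b n) \<le> h m * (C * (h m + h n))"
      using h[of m] by (simp add: power2_eq_square distrib_left mult.left_commute)
    thus ?thesis using h[of m] by simp
  qed
  have "\<exists>y. q b \<longlonglongrightarrow> y" if b: "b \<in> Basis" for b
  proof -
    have "Cauchy (q b)"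
    proof (rule metric_CauchyI)
      fix e :: real assume e: "e > 0"
      have "(\<lambda>n. C * h n) \<longlonglongrightarrow> C * 0" by (intro tendsto_intros h0)
      hence "\<forall>\<^sub>F n in sequentially. C * h n < e / 2" by (rule order_tendstoD) (use e in simp)
      then obtain N where N: "\<And>n. n \<ge> N \<Longrightarrow> C * h n < e / 2" unfolding eventually_sequentially by blast
      show "\<exists>M. \<forall>m\<ge>M. \<forall>n\<ge>M. dist (q b m) (q b n) < e"
      proof (intro exI[of _ N] allI impI)
        fix m n assume "m \<ge> N" "n \<ge> N"
        thus "dist (q b m) (q b n) < e"
          using N[of m] N[of n] q[OF b, of m n] by (simp add: dist_norm distrib_left)
      qed
    qed
    thus ?thesis using Cauchy_convergent convergent_def by blast
  qed
  then obtain y where y: "\<And>b. b \<in> Basis \<Longrightarrow> q b \<longlonglongrightarrow> y b" by metis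
  define L where "L v = (\<Sum>b\<in>Basis. (v \<bullet> b) *\<^sub>R y b)" for v
  have lin: "bounded_linear L" unfolding L_def
    by (intro bounded_linear_sum
        bounded_linear_compose[OF bounded_linear_scaleR_left bounded_linear_inner_left])
  have bound: "norm (f v - L v) \<le> C * (norm v)\<^sup>2" if v: "norm v < \<delta>" for v
  proof (rule LIMSEQ_le)
    show "(\<lambda>n. norm (f v - (\<Sum>b\<in>Basis. (v \<bullet> b) *\<^sub>R q b n))) \<longlonglongrightarrow> norm (f v - L v)"
      unfolding L_def by (intro tendsto_intros y)
    have "(\<lambda>n. C * ((norm v)\<^sup>2 + norm v * h n)) \<longlonglongrightarrow> C * ((norm v)\<^sup>2 + norm v * 0)"
      by (intro tendsto_intros h0)
    thus "(\<lambda>n. C * ((norm v)\<^sup>2 + norm v * h n)) \<longlonglongrightarrow> C * (norm v)\<^sup>2" by simp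
    show "\<exists>N. \<forall>n\<ge>N. norm (f v - (\<Sum>b\<in>Basis. (v \<bullet> b) *\<^sub>R q b n)) \<le> C * ((norm v)\<^sup>2 + norm v * h n)"
      using approx[OF v] h unfolding q_def by blast
  qed
  have "(f has_derivative L) (at 0)"
  proof (rule has_derivativeI_sandwich[where H="\<lambda>v. C * norm v" and e=\<delta>])
    fix v :: 'a assume v: "v \<noteq> 0" "dist v 0 < \<delta>"
    have "norm (f v - f 0 - L (v - 0)) / norm (v - 0) \<le> C * (norm v)\<^sup>2 / norm v"
      using bound[of v] v f0 by (simp add: divide_right_mono)
    thus "norm (f v - f 0 - L (v - 0)) / norm (v - 0) \<le> C * norm v"
      using v by (simp add: power2_eq_square)
  next
    have "((\<lambda>v::'a. C * norm v) \<longlongrightarrow> C * norm (0::'a)) (at 0)" by (intro tendsto_intros)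
    thus "((\<lambda>v::'a. C * norm v) \<longlongrightarrow> 0) (at 0)" by simp
  qed (use \<delta> lin in auto)
  thus ?thesis unfolding differentiable_def by blast
qed

lemma norm_scaled_quadratic:
  fixes x :: "'a::real_normed_vector"
  assumes "norm x \<le> C * (h * c)\<^sup>2" "0 < h"
  shows "norm (x /\<^sub>R h) \<le> C * c\<^sup>2 * h"
proof -
  have "norm (x /\<^sub>R h) = norm x / h" 
    using assms(2) unfolding norm_scaleR divide_inverse by (subst mult.commute) simp
  also have "\<dots> \<le> C * (h * c)\<^sup>2 / h" using assms by (intro divide_right_mono) auto
  also have "\<dots> = C * c\<^sup>2 * h" using assms(2) by (simp add: power2_eq_square)
  finally show ?thesis .
qed

text \<open>The trajectory from \<open>a\<close> is singled out because only it has to lie in the set \<open>W\<close> where \<open>F\<close> is regular: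
nearby trajectories are shown to remain close to it on the whole time interval.\<close>

locale flow_around_trajectory =
  fixes F :: "'a::euclidean_space \<times> real \<Rightarrow> 'a" and W :: "('a \<times> real) set"
    and X :: "'a \<Rightarrow> real \<Rightarrow> 'a" and R :: "'a set" and a :: 'a and T :: real
  assumes W: "open W" and F: "Ck_on (Suc (Suc 0)) W F"
    and R: "open R" "a \<in> R"
    and X_initial: "\<And>b. b \<in> R \<Longrightarrow> X b 0 = b"
    and X_deriv: "\<And>b s. b \<in> R \<Longrightarrow> s \<in> {0..T} \<Longrightarrow>
      (X b has_vector_derivative F (X b s, s)) (at s within {0..T})"
    and inW: "\<And>s. s \<in> {0..T} \<Longrightarrow> (X a s, s) \<in> W"
begin

text \<open>The coefficient of the variational equation along the trajectory from \<open>a\<close>.\<close>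

definition A :: "real \<Rightarrow> 'a \<Rightarrow> 'a" where
  "A s \<xi> = dir_deriv (\<xi>, 0) F (X a s, s)"

definition deviation :: "'a \<Rightarrow> real \<Rightarrow> 'a" where
  "deviation v s = X (a + v) s - X a s"

definition remainder :: "'a \<Rightarrow> real \<Rightarrow> 'a" where
  "remainder v s = F (X (a + v) s, s) - F (X a s, s) - A s (deviation v s)"

lemma linear_A: "s \<in> {0..T} \<Longrightarrow> linear (A s)"
proof -
  assume s: "s \<in> {0..T}"
  have "linear (\<lambda>v. dir_deriv v F (X a s, s))"
    by (rule dir_deriv_linear) (use F inW[OF s] in auto)
  moreover have "linear (\<lambda>\<xi>::'a. (\<xi>, 0::real))" by (auto intro!: linearI)
  ultimately have "linear ((\<lambda>v. dir_deriv v F (X a s, s)) \<circ> (\<lambda>\<xi>. (\<xi>, 0)))"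
    by (intro linear_compose)
  thus ?thesis by (simp add: o_def A_def[abs_def])
qed

text \<open>For negative \<open>T\<close> the time interval is empty and so is the tube.\<close>

lemma compact_tube:
  obtains r K where "r > 0" "compact K" "K \<subseteq> W"
    "\<And>s \<xi>. s \<in> {0..T} \<Longrightarrow> norm \<xi> \<le> r \<Longrightarrow> (X a s + \<xi>, s) \<in> K"
proof (cases "0 \<le> T")
  case True
  define C where "C = (\<lambda>s. (X a s, s)) ` {0..T}"
  have "continuous_on {0..T} (X a)"
    using X_deriv[OF R(2)] has_vector_derivative_continuous continuous_on_eq_continuous_within by blast
  hence C: "compact C" "C \<noteq> {}" "C \<subseteq> W"
    using True inW unfolding C_def by (auto intro!: compact_continuous_image continuous_intros)
  obtain e where e: "e > 0" "(\<Union>x\<in>C. ball x e) \<subseteq> W"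
    by (rule compact_subset_open_imp_ball_epsilon_subset[OF C(1) W C(3)])
  define K where "K = {x. infdist x C \<le> e / 2}"
  show thesis
  proof (rule that)
    show "e / 2 > 0" using e by simp
    show "compact K" unfolding K_def by (rule compact_infdist_le[OF C(2,1)]) (use e in simp)
    show "K \<subseteq> W"
    proof
      fix x assume "x \<in> K"
      obtain c where "c \<in> C" "infdist x C = dist x c"
        using infdist_attains_inf[of C x] C compact_imp_closed by blast
      thus "x \<in> W" using \<open>x \<in> K\<close> e by (force simp: K_def dist_commute)
    qed
    fix s and \<xi> :: 'a assume s: "s \<in> {0..T}" and \<xi>: "norm \<xi> \<le> e / 2"
    have "infdist (X a s + \<xi>, s) C \<le> dist (X a s + \<xi>, s) (X a s, s)"
      by (rule infdist_le) (use s in \<open>auto simp: C_def\<close>)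
    also have "\<dots> = norm \<xi>" by (simp add: dist_Pair_Pair dist_norm)
    finally show "(X a s + \<xi>, s) \<in> K" using \<xi> by (simp add: K_def)
  qed
qed (rule that[of 1 "{}"], auto)

text \<open>First and second order bounds for \<open>F\<close> at a fixed time, uniform along the trajectory. Both follow from the mean value
inequality on horizontal segments, which stay in the compact tube.\<close>

lemma local_expansion:
  obtains r L B where "r > 0" "L \<ge> 0" "B \<ge> 0"
    "\<And>s \<xi>. s \<in> {0..T} \<Longrightarrow> norm (A s \<xi>) \<le> L * norm \<xi>"
    "\<And>s \<xi>. s \<in> {0..T} \<Longrightarrow> norm \<xi> \<le> r \<Longrightarrow> norm (F (X a s + \<xi>, s) - F (X a s, s)) \<le> L * norm \<xi>"
    "\<And>s \<xi>. s \<in> {0..T} \<Longrightarrow> norm \<xi> \<le> r \<Longrightarrow>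
       norm (F (X a s + \<xi>, s) - F (X a s, s) - A s \<xi>) \<le> B * (norm \<xi>)\<^sup>2"
proof -
  obtain r K where r: "r > 0" and K: "compact K" "K \<subseteq> W"
    and tube: "\<And>s \<xi>. s \<in> {0..T} \<Longrightarrow> norm \<xi> \<le> r \<Longrightarrow> (X a s + \<xi>, s) \<in> K"
    by (rule compact_tube) (rule that)
  have F1: "Ck_on (Suc 0) W F"
    using F Ck_on_continuous[OF Ck_on_dir_deriv[OF F]] by simp
  obtain L where L: "L \<ge> 0" "\<And>p v. p \<in> K \<Longrightarrow> norm (dir_deriv v F p) \<le> L * norm v"
    using C1_dir_deriv_bounded[OF F1 K] by blast
  obtain B where B: "B \<ge> 0" "\<And>p q. closed_segment p q \<subseteq> K \<Longrightarrow>
      norm (F q - F p - dir_deriv (q - p) F p) \<le> B * (norm (q - p))\<^sup>2"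
    using C2_taylor[OF F K] by blast
  have seg: "closed_segment (X a s, s) (X a s + \<xi>, s) \<subseteq> K" if "s \<in> {0..T}" "norm \<xi> \<le> r" for s \<xi>
  proof
    fix p assume "p \<in> closed_segment (X a s, s) (X a s + \<xi>, s)"
    then obtain c where c: "0 \<le> c" "c \<le> 1"
      and "p = (1 - c) *\<^sub>R (X a s, s) + c *\<^sub>R (X a s + \<xi>, s)"
      by (auto simp: closed_segment_def)
    hence "p = (X a s + c *\<^sub>R \<xi>, s)" by (simp add: algebra_simps)
    moreover have "norm (c *\<^sub>R \<xi>) \<le> r"
      using c that mult_right_mono[of c 1 "norm \<xi>"] by simp
    ultimately show "p \<in> K" using tube that by simp
  qed
  show thesis
  proof (rule that[OF r L(1) B(1)])
    fix s and \<xi> :: 'a assume s: "s \<in> {0..T}"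
    show "norm (A s \<xi>) \<le> L * norm \<xi>"
      using L(2)[of "(X a s, s)" "(\<xi>, 0)"] tube[OF s, of 0] r by (simp add: A_def norm_Pair)
    assume \<xi>: "norm \<xi> \<le> r"
    have "norm (F (X a s, s) - F (X a s + \<xi>, s)) \<le> L * norm ((X a s, s) - (X a s + \<xi>, s))"
    proof (rule segment_mean_value)
      fix p assume "p \<in> closed_segment (X a s, s) (X a s + \<xi>, s)"
      hence "p \<in> K" using seg[OF s \<xi>] by blast
      thus "F differentiable at p" "norm (dir_deriv v F p) \<le> L * norm v" for v
        using L K F by auto
    qed (rule L(1))
    thus "norm (F (X a s + \<xi>, s) - F (X a s, s)) \<le> L * norm \<xi>"
      by (simp add: norm_Pair norm_minus_commute)
    show "norm (F (X a s + \<xi>, s) - F (X a s, s) - A s \<xi>) \<le> B * (norm \<xi>)\<^sup>2"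
      using B(2)[OF seg[OF s \<xi>]] by (simp add: A_def norm_Pair)
  qed
qed

lemma deviation_deriv:
  assumes "a + v \<in> R" "s \<in> {0..T}"
  shows "(deviation v has_vector_derivative A s (deviation v s) + remainder v s) (at s within {0..T})"
proof -
  have "((\<lambda>s. X (a + v) s - X a s) has_vector_derivative F (X (a + v) s, s) - F (X a s, s))
      (at s within {0..T})"
    by (intro has_vector_derivative_diff X_deriv assms R)
  thus ?thesis by (simp add: remainder_def deviation_def[abs_def])
qed

lemma deviation_initial: "a + v \<in> R \<Longrightarrow> deviation v 0 = v"
  using R(2) by (simp add: deviation_def X_initial)

text \<open>The bootstrap form of Gronwall's inequality keeps the deviation within the tube and proportional to
the initial separation \<open>v\<close>; the second order bound of the tube then applies at all times.\<close>

lemma remainder_quadratic: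
  obtains \<delta> C where "\<delta> > 0" "C \<ge> 0"
    "\<And>v. norm v < \<delta> \<Longrightarrow> a + v \<in> R"
    "\<And>v s. norm v < \<delta> \<Longrightarrow> s \<in> {0..T} \<Longrightarrow> norm (remainder v s) \<le> C * (norm v)\<^sup>2"
proof -
  obtain r L B where r: "r > 0" and L: "L \<ge> 0" and B: "B \<ge> 0"
    and lip: "\<And>s \<xi>. s \<in> {0..T} \<Longrightarrow> norm \<xi> \<le> r \<Longrightarrow> norm (F (X a s + \<xi>, s) - F (X a s, s)) \<le> L * norm \<xi>"
    and rem: "\<And>s \<xi>. s \<in> {0..T} \<Longrightarrow> norm \<xi> \<le> r \<Longrightarrow>
       norm (F (X a s + \<xi>, s) - F (X a s, s) - A s \<xi>) \<le> B * (norm \<xi>)\<^sup>2"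
    by (rule local_expansion) (rule that)
  obtain \<rho> where \<rho>: "\<rho> > 0" "ball a \<rho> \<subseteq> R" using R openE by blast
  define E where "E = exp ((L + 1) * T)"
  have E: "E > 0" by (simp add: E_def)
  show thesis
  proof (rule that)
    show "min \<rho> (r / E) > 0" using r \<rho> E by simp
    show "B * E\<^sup>2 \<ge> 0" using B by simp
    fix v :: 'a assume v: "norm v < min \<rho> (r / E)"
    hence "a + v \<in> ball a \<rho>" by (simp add: dist_norm)
    thus av: "a + v \<in> R" using \<rho> by blast
    fix s assume s: "s \<in> {0..T}"
    have X_eq: "X (a + v) s = X a s + deviation v s" for s by (simp add: deviation_def)
    have small: "exp ((L + 1) * T) * norm (deviation v 0) < r"
      using v E unfolding deviation_initial[OF av] E_def[symmetric]
      by (simp add: pos_less_divide_eq mult.commute)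
    have growth: "norm (A s (deviation v s) + remainder v s) \<le> L * norm (deviation v s)"
      if "s \<in> {0..T}" "norm (deviation v s) \<le> r" for s
      using lip[OF that] by (simp add: remainder_def X_eq)
    note boot = norm_gronwall_bootstrap[where z="deviation v" and r=r
      and z'="\<lambda>s. A s (deviation v s) + remainder v s", OF deviation_deriv[OF av] growth L small s]
    have "norm (remainder v s) \<le> B * (norm (deviation v s))\<^sup>2"
      using rem[OF s, of "deviation v s"] boot(2) by (simp add: remainder_def X_eq)
    also have "\<dots> \<le> B * (E * norm v)\<^sup>2"
      using boot(1) B by (intro mult_left_mono power_mono) (auto simp: deviation_initial[OF av] E_def)
    finally show "norm (remainder v s) \<le> B * E\<^sup>2 * (norm v)\<^sup>2"
      by (simp add: power_mult_distrib mult.assoc)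
  qed
qed

text \<open>The form in which Gronwall's inequality is used below. The constant \<open>E\<close> depends on the trajectory only,
and neither on the perturbation \<open>g\<close> nor on its size.\<close>

lemma perturbed_linear_estimate:
  "\<exists>E\<ge>0. \<forall>z g \<epsilon>. (\<forall>s\<in>{0..T}. (z has_vector_derivative A s (z s) + g s) (at s within {0..T})) \<longrightarrow>
      (\<forall>s\<in>{0..T}. norm (g s) \<le> \<epsilon>) \<longrightarrow> z 0 = 0 \<longrightarrow> (\<forall>s\<in>{0..T}. norm (z s) \<le> E * \<epsilon>)"
proof -
  obtain L where L: "L \<ge> 0" "\<And>s \<xi>. s \<in> {0..T} \<Longrightarrow> norm (A s \<xi>) \<le> L * norm \<xi>"
    by (rule local_expansion) (rule that)
  show ?thesis
  proof (intro exI[of _ "exp ((L + 1) * T)"] conjI allI impI ballI)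
    fix z g :: "real \<Rightarrow> 'a" and \<epsilon> s
    assume z: "\<forall>s\<in>{0..T}. (z has_vector_derivative A s (z s) + g s) (at s within {0..T})"
      and g: "\<forall>s\<in>{0..T}. norm (g s) \<le> \<epsilon>" and z0: "z 0 = 0" and s: "s \<in> {0..T}"
    have "0 \<le> \<epsilon>" using g s norm_ge_zero order_trans by blast
    have "norm (A s (z s) + g s) \<le> L * norm (z s) + \<epsilon>" if "s \<in> {0..T}" for s
      by (rule norm_triangle_le[OF add_mono[OF L(2)[OF that]]]) (use g that in blast)
    from norm_gronwall[where z=z and z'="\<lambda>s. A s (z s) + g s", OF bspec[OF z] this L(1) \<open>0 \<le> \<epsilon>\<close> s]
    show "norm (z s) \<le> exp ((L + 1) * T) * \<epsilon>" by (simp add: z0)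
  qed simp
qed

text \<open>A linear combination of deviations whose initial separations cancel solves the variational equation
up to the corresponding combination of remainders, so it stays of quadratic size. This is precisely
approximate linearity of the deviation at time \<open>t\<close> in the initial separation.\<close>

theorem flow_differentiable:
  assumes t: "t \<in> {0..T}"
  shows "(\<lambda>b. X b t) differentiable at a"
proof -
  obtain \<delta> C where \<delta>: "\<delta> > 0" and C: "C \<ge> 0" and dR: "\<And>v. norm v < \<delta> \<Longrightarrow> a + v \<in> R"
    and rem: "\<And>v s. norm v < \<delta> \<Longrightarrow> s \<in> {0..T} \<Longrightarrow> norm (remainder v s) \<le> C * (norm v)\<^sup>2"
    by (rule remainder_quadratic) (rule that)
  obtain E where E: "E \<ge> 0" and est:
    "\<forall>z g \<epsilon>.
      (\<forall>s\<in>{0..T}. (z has_vector_derivative A s (z s) + g s) (at s within {0..T})) \<longrightarrow>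
      (\<forall>s\<in>{0..T}. norm (g s) \<le> \<epsilon>) \<longrightarrow> z 0 = 0 \<longrightarrow> (\<forall>s\<in>{0..T}. norm (z s) \<le> E * \<epsilon>)"
    using perturbed_linear_estimate by blast
  have D: "real DIM('a) \<ge> 1" using DIM_positive[where 'a='a] by simp
  have "(\<lambda>v. deviation v t) differentiable at 0"
  proof (rule differentiable_of_approximate_linearity[OF \<delta>])
    show "0 \<le> E * (C * real DIM('a))" using E C by simp
    show "deviation 0 t = 0" by (simp add: deviation_def)
    fix v :: 'a and h :: real assume v: "norm v < \<delta>" and h: "0 < h" "h < \<delta>"
    have hb: "norm (h *\<^sub>R b) < \<delta>" if "b \<in> Basis" for b :: 'a using h that by simp
    let ?S = "\<lambda>f. \<Sum>b\<in>Basis. (v \<bullet> b) *\<^sub>R (f (h *\<^sub>R b) /\<^sub>R h) :: 'a"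
    define z where "z s = deviation v s - ?S (\<lambda>v. deviation v s)" for s
    define g where "g s = remainder v s - ?S (\<lambda>v. remainder v s)" for s
    have "norm (z t) \<le> E * (C * real DIM('a) * ((norm v)\<^sup>2 + norm v * h))"
    proof (rule est[rule_format, OF _ _ _ t])
      fix s assume s: "s \<in> {0..T}"
      interpret A: linear "A s" by (rule linear_A[OF s])
      have "(z has_vector_derivative (A s (deviation v s) + remainder v s)
          - ?S (\<lambda>v. A s (deviation v s) + remainder v s)) (at s within {0..T})"
        unfolding z_def[abs_def]
        by (intro has_vector_derivative_diff has_vector_derivative_sum
            deviation_deriv dR v hb s bounded_linear.has_vector_derivative[OF bounded_linear_scaleR_right])
      also have "(A s (deviation v s) + remainder v s) - ?S (\<lambda>v. A s (deviation v s) + remainder v s)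
          = A s (z s) + g s"
        by (simp add: z_def g_def A.diff A.sum A.scale sum.distrib scaleR_add_right)
      finally show "(z has_vector_derivative A s (z s) + g s) (at s within {0..T})" .
      have "norm (g s) \<le> C * (norm v)\<^sup>2 + (\<Sum>b\<in>(Basis::'a set). norm v * (C * h))"
        unfolding g_def
      proof (rule order_trans[OF norm_triangle_ineq4 add_mono[OF rem[OF v s]]])
        have "norm ((v \<bullet> b) *\<^sub>R (remainder (h *\<^sub>R b) s /\<^sub>R h)) \<le> norm v * (C * h)" if b: "b \<in> Basis" for b
        proof -
          have "norm (remainder (h *\<^sub>R b) s /\<^sub>R h) \<le> C * h"
            using norm_scaled_quadratic[of "remainder (h *\<^sub>R b) s" C h 1] rem[OF hb[OF b] s] h b by simp
          thus ?thesis unfolding norm_scaleR[of "v \<bullet> b"]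
            by (intro mult_mono) (auto simp: Basis_le_norm b)
        qed
        thus "norm (?S (\<lambda>v. remainder v s)) \<le> (\<Sum>b\<in>(Basis::'a set). norm v * (C * h))"
          by (rule sum_norm_le)
      qed
      also have "\<dots> = C * (norm v)\<^sup>2 * 1 + C * (norm v * h) * real DIM('a)" by simp
      also have "\<dots> \<le> C * (norm v)\<^sup>2 * real DIM('a) + C * (norm v * h) * real DIM('a)"
        using C D h by (intro add_mono mult_left_mono) auto
      finally show "norm (g s) \<le> C * real DIM('a) * ((norm v)\<^sup>2 + norm v * h)"
        by (simp add: algebra_simps)
    next
      have "?S (\<lambda>v. deviation v 0) = (\<Sum>b\<in>Basis. (v \<bullet> b) *\<^sub>R b)"
        using h by (intro sum.cong refl) (simp add: deviation_initial[OF dR[OF hb]])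
      thus "z 0 = 0" by (simp add: z_def deviation_initial[OF dR[OF v]] euclidean_representation)
    qed
    thus "norm (deviation v t - ?S (\<lambda>v. deviation v t)) \<le> E * (C * real DIM('a)) * ((norm v)\<^sup>2 + norm v * h)"
      by (simp add: z_def mult.assoc)
  qed
  then obtain D where D: "((\<lambda>v. deviation v t) has_derivative D) (at (a - a))"
    unfolding differentiable_def by auto
  have "((\<lambda>b. b - a) has_derivative (\<lambda>v. v)) (at a)" by (auto intro!: derivative_eq_intros)
  from has_derivative_add_const[OF has_derivative_compose[OF this D], of "X a t"]
  have "(\<lambda>b. deviation (b - a) t + X a t) differentiable at a" unfolding differentiable_def by blast
  thus ?thesis by (simp add: deviation_def)
qed

text \<open>The rescaled deviation for the separation \<open>h w 0\<close> and the solution \<open>w\<close> start at the same point, and the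
rescaled remainder is of size \<open>h\<close>. Hence the difference quotients of the flow in the direction \<open>w 0\<close>
converge to \<open>w t\<close>.\<close>

theorem flow_derivative_transports:
  assumes w: "\<And>s. s \<in> {0..T} \<Longrightarrow> (w has_vector_derivative A s (w s)) (at s within {0..T})"
    and t: "t \<in> {0..T}"
  shows "dir_deriv (w 0) (\<lambda>b. X b t) a = w t"
proof -
  obtain \<delta> C where \<delta>: "\<delta> > 0" and C: "C \<ge> 0" and dR: "\<And>v. norm v < \<delta> \<Longrightarrow> a + v \<in> R"
    and rem: "\<And>v s. norm v < \<delta> \<Longrightarrow> s \<in> {0..T} \<Longrightarrow> norm (remainder v s) \<le> C * (norm v)\<^sup>2"
    by (rule remainder_quadratic) (rule that)
  obtain E where E: "E \<ge> 0" and est: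
    "\<forall>z g \<epsilon>.
      (\<forall>s\<in>{0..T}. (z has_vector_derivative A s (z s) + g s) (at s within {0..T})) \<longrightarrow>
      (\<forall>s\<in>{0..T}. norm (g s) \<le> \<epsilon>) \<longrightarrow> z 0 = 0 \<longrightarrow> (\<forall>s\<in>{0..T}. norm (z s) \<le> E * \<epsilon>)"
    using perturbed_linear_estimate by blast
  let ?D = "\<lambda>v. dir_deriv v (\<lambda>b. X b t) a"
  have D: "((\<lambda>b. X b t) has_derivative ?D) (at a)"
    using flow_differentiable[OF t] by (simp add: frechet_derivative_works)
  have line: "((\<lambda>h. X (a + h *\<^sub>R w 0) t) has_vector_derivative ?D (w 0)) (at 0)"
  proof -
    have "((\<lambda>h. a + h *\<^sub>R w 0) has_vector_derivative w 0) (at 0)"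
      by (auto intro!: derivative_eq_intros)
    moreover have "((\<lambda>b. X b t) has_derivative ?D) (at (a + 0 *\<^sub>R w 0) within range (\<lambda>h. a + h *\<^sub>R w 0))"
      using D by (simp add: has_derivative_at_withinI)
    ultimately show ?thesis
      using vector_derivative_diff_chain_within[of "\<lambda>h. a + h *\<^sub>R w 0" "w 0" 0 UNIV "\<lambda>b. X b t" ?D]
      by (simp add: o_def)
  qed
  hence "((\<lambda>h. X (a + h *\<^sub>R w 0) t) has_derivative (\<lambda>h. h *\<^sub>R ?D (w 0))) (at_right 0)"
    unfolding has_vector_derivative_def by (rule has_derivative_at_withinI)
  hence "((\<lambda>h. (X (a + h *\<^sub>R w 0) t - X a t - h *\<^sub>R ?D (w 0)) /\<^sub>R norm h) \<longlongrightarrow> 0) (at_right 0)"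
    unfolding has_derivative_at_within by simp
  moreover have "\<forall>\<^sub>F h in at_right 0. (X (a + h *\<^sub>R w 0) t - X a t - h *\<^sub>R ?D (w 0)) /\<^sub>R norm h
      = (X (a + h *\<^sub>R w 0) t - X a t) /\<^sub>R h - ?D (w 0)"
    by (simp add: eventually_at_filter scaleR_diff_right)
  ultimately have "((\<lambda>h. (X (a + h *\<^sub>R w 0) t - X a t) /\<^sub>R h - ?D (w 0)) \<longlongrightarrow> 0) (at_right 0)"
    by (rule Lim_transform_eventually)
  hence lim: "((\<lambda>h. (X (a + h *\<^sub>R w 0) t - X a t) /\<^sub>R h) \<longlongrightarrow> ?D (w 0)) (at_right 0)"
    by (rule Lim_null[THEN iffD2])
  have "((\<lambda>h. norm ((X (a + h *\<^sub>R w 0) t - X a t) /\<^sub>R h - w t)) \<longlongrightarrow> 0) (at_right 0)"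
  proof (rule tendsto_sandwich[OF _ _ tendsto_const])
    show "((\<lambda>h. E * (C * (norm (w 0))\<^sup>2 * h)) \<longlongrightarrow> 0) (at_right 0)"
      by (auto intro!: tendsto_eq_intros)
    have "norm ((X (a + h *\<^sub>R w 0) t - X a t) /\<^sub>R h - w t) \<le> E * (C * (norm (w 0))\<^sup>2 * h)"
      if h: "0 < h" "h < \<delta> / (norm (w 0) + 1)" for h
    proof -
      have "h * norm (w 0) \<le> h * (norm (w 0) + 1)" using h by simp
      also have "\<dots> < \<delta>" using h by (simp add: less_divide_eq add_nonneg_pos)
      finally have hw: "norm (h *\<^sub>R w 0) < \<delta>" using h by simp
      define z where "z s = deviation (h *\<^sub>R w 0) s /\<^sub>R h - w s" for s
      have "norm (z t) \<le> E * (C * (norm (w 0))\<^sup>2 * h)"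
      proof (rule est[rule_format, OF _ _ _ t])
        fix s assume s: "s \<in> {0..T}"
        interpret A: linear "A s" by (rule linear_A[OF s])
        have "(z has_vector_derivative
            (A s (deviation (h *\<^sub>R w 0) s) + remainder (h *\<^sub>R w 0) s) /\<^sub>R h - A s (w s)) (at s within {0..T})"
          unfolding z_def[abs_def]
          by (intro has_vector_derivative_diff w s deviation_deriv dR hw
              bounded_linear.has_vector_derivative[OF bounded_linear_scaleR_right])
        thus "(z has_vector_derivative A s (z s) + remainder (h *\<^sub>R w 0) s /\<^sub>R h) (at s within {0..T})"
          by (simp add: z_def A.diff A.scale scaleR_add_right algebra_simps)
        show "norm (remainder (h *\<^sub>R w 0) s /\<^sub>R h) \<le> C * (norm (w 0))\<^sup>2 * h"
          using norm_scaled_quadratic[of "remainder (h *\<^sub>R w 0) s" C h "norm (w 0)"] rem[OF hw s] h by simp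
      qed (use h in \<open>simp add: z_def deviation_initial[OF dR[OF hw]]\<close>)
      thus ?thesis by (simp add: z_def deviation_def)
    qed
    thus "\<forall>\<^sub>F h in at_right 0. norm ((X (a + h *\<^sub>R w 0) t - X a t) /\<^sub>R h - w t) \<le> E * (C * (norm (w 0))\<^sup>2 * h)"
      using \<delta> by (auto simp: eventually_at_right_field add_nonneg_pos intro!: exI[of _ "\<delta> / (norm (w 0) + 1)"])
  qed simp
  hence "((\<lambda>h. (X (a + h *\<^sub>R w 0) t - X a t) /\<^sub>R h) \<longlongrightarrow> w t) (at_right 0)"
    by (subst Lim_null) (simp add: tendsto_norm_zero_iff)
  with lim show ?thesis by (rule tendsto_unique[OF trivial_limit_at_right_real])
qed

end

section \<open>Tangential transport cannot reach the boundary\<close>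

lemma has_real_derivative_along_line:
  fixes f :: "'a::real_normed_vector \<Rightarrow> real"
  assumes "f differentiable at (x + s *\<^sub>R v)"
  shows "((\<lambda>s. f (x + s *\<^sub>R v)) has_real_derivative dir_deriv v f (x + s *\<^sub>R v)) (at s)"
proof -
  have "((\<lambda>s. x + s *\<^sub>R v) has_derivative (\<lambda>h. h *\<^sub>R v)) (at s)"
    by (auto intro!: derivative_eq_intros)
  from has_derivative_compose[OF this assms[unfolded frechet_derivative_works]]
  have "((\<lambda>s. f (x + s *\<^sub>R v)) has_derivative (\<lambda>h. h * dir_deriv v f (x + s *\<^sub>R v))) (at s)"
    by (simp add: linear_scale[OF dir_deriv_linear[OF assms]])
  thus ?thesis by (simp only: has_field_derivative_def mult_commute_abs)
qed

text \<open>The rate of change \<open>\<nabla>\<phi> \<bullet> G\<close> of \<open>\<phi>\<close> along the field vanishes where \<open>\<phi>\<close> does and is Lipschitz in the position,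
so it is bounded by the distance to the zero set. That distance is at most a multiple of \<open>\<bar>\<phi>\<bar>\<close>, because \<open>\<phi>\<close>
grows at a definite rate in the direction \<open>N\<close>.\<close>

lemma tangential_rate_bound:
  fixes \<phi> :: "'a::euclidean_space \<Rightarrow> real" and G :: "'a \<times> real \<Rightarrow> 'a"
  assumes U: "open U" "p \<in> U" and \<phi>: "Ck_on (Suc (Suc 0)) U \<phi>"
    and p: "\<phi> p = 0" and N: "dir_deriv N \<phi> p > 0"
    and W: "open W" "(p, t0) \<in> W" and G: "Ck_on (Suc 0) W G"
    and tangent: "\<And>y t. y \<in> U \<Longrightarrow> \<phi> y = 0 \<Longrightarrow> t \<in> S \<Longrightarrow> dir_deriv (G (y, t)) \<phi> y = 0"
  shows "\<exists>\<rho>>0. \<exists>C\<ge>0. ball p \<rho> \<subseteq> U \<and> (\<forall>x t. dist x p < \<rho> \<longrightarrow> dist t t0 < \<rho> \<longrightarrow> t \<in> S \<longrightarrow> \<phi> x < 0 \<longrightarrow>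
           \<bar>dir_deriv (G (x, t)) \<phi> x\<bar> \<le> C * \<bar>\<phi> x\<bar>)"
proof -
  define c where "c = dir_deriv N \<phi> p / 2"
  have c: "c > 0" using N by (simp add: c_def)
  obtain V I where VI: "open V" "open I" "p \<in> V" "t0 \<in> I" "V \<times> I \<subseteq> W"
    using open_prod_elim[OF W] by (metis mem_Sigma_iff)
  define V' where "V' = V \<inter> {x \<in> U. dir_deriv N \<phi> x > c}"
  have "open {x \<in> U. dir_deriv N \<phi> x > c}"
  proof -
    have "continuous_on U (dir_deriv N \<phi>)" by (rule Ck_on_continuous[OF Ck_on_dir_deriv[OF \<phi>]])
    from continuous_open_preimage[OF this U(1), of "{c<..}"]
    show ?thesis by (simp add: vimage_def Int_def)
  qed
  hence "open V'" "p \<in> V'" using VI U N by (auto simp: V'_def c_def)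
  then obtain r1 where r1: "r1 > 0" "cball p r1 \<subseteq> V'" using open_contains_cball by blast
  obtain r2 where r2: "r2 > 0" "cball t0 r2 \<subseteq> I" using VI open_contains_cball by blast
  define r where "r = min r1 r2"
  have r: "r > 0" "cball p r \<subseteq> V'" "cball t0 r \<subseteq> I" using r1 r2 by (auto simp: r_def)
  have KU: "cball p r \<subseteq> U" and KW: "cball p r \<times> cball t0 r \<subseteq> W"
    and slope: "\<And>x. x \<in> cball p r \<Longrightarrow> dir_deriv N \<phi> x \<ge> c"
    using r VI by (auto simp: V'_def)
  have cpt: "compact (cball p r)" "compact (cball p r \<times> cball t0 r)" by (auto intro: compact_Times)
  have \<phi>1: "Ck_on (Suc 0) U \<phi>" using \<phi> Ck_on_continuous[OF Ck_on_dir_deriv[OF \<phi>]] by simp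
  obtain B1 where B1: "B1 \<ge> 0" "\<And>x v. x \<in> cball p r \<Longrightarrow> norm (dir_deriv v \<phi> x) \<le> B1 * norm v"
    using C1_dir_deriv_bounded[OF \<phi>1 cpt(1) KU] by blast
  obtain B2 where B2: "B2 \<ge> 0" "\<And>x y v. closed_segment x y \<subseteq> cball p r \<Longrightarrow>
      norm (dir_deriv v \<phi> x - dir_deriv v \<phi> y) \<le> B2 * norm (x - y) * norm v"
    using C2_dir_deriv_lipschitz[OF \<phi> cpt(1) KU] by blast
  obtain L where L: "L \<ge> 0" "\<And>q v. q \<in> cball p r \<times> cball t0 r \<Longrightarrow> norm (dir_deriv v G q) \<le> L * norm v"
    using C1_dir_deriv_bounded[OF G cpt(2) KW] by blast
  have "bounded (G ` (cball p r \<times> cball t0 r))"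
    by (intro compact_imp_bounded compact_continuous_image cpt continuous_on_subset[OF Ck_on_continuous[OF G] KW])
  then obtain M where M: "M > 0" "\<And>q. q \<in> cball p r \<times> cball t0 r \<Longrightarrow> norm (G q) \<le> M"
    unfolding bounded_pos by blast
  have lipG: "norm (G (x, t) - G (y, t)) \<le> L * norm (x - y)"
    if "x \<in> cball p r" "y \<in> cball p r" "t \<in> cball t0 r" for x y t
  proof -
    have sub: "closed_segment (x, t) (y, t) \<subseteq> cball p r \<times> cball t0 r"
      by (rule closed_segment_subset) (use that in \<open>auto intro!: convex_Times simp del: mem_cball\<close>)
    have "norm (G (x, t) - G (y, t)) \<le> L * norm ((x, t) - (y, t))"
    proof (rule segment_mean_value)
      fix q assume "q \<in> closed_segment (x, t) (y, t)"
      hence q: "q \<in> cball p r \<times> cball t0 r" using sub by blast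
      show "G differentiable at q" using q KW G by auto
      show "norm (dir_deriv v G q) \<le> L * norm v" for v by (rule L(2)[OF q])
    qed (rule L(1))
    thus ?thesis by (simp add: norm_Pair)
  qed
  \<comment> \<open>If \<open>\<bar>\<phi> x\<bar> < m\<close> then the zero of \<open>\<phi>\<close> is found within distance \<open>r / 2\<close> of \<open>x\<close>, still inside the ball.\<close>
  define m where "m = c * r / (2 * (norm N + 1))"
  have m: "m > 0" using c r by (simp add: m_def add_nonneg_pos)
  have "isCont \<phi> p"
    using Ck_on_continuous[OF \<phi>] U continuous_on_eq_continuous_at by blast
  then obtain r3 where r3: "r3 > 0" "\<And>x. dist x p < r3 \<Longrightarrow> dist (\<phi> x) (\<phi> p) < m"
    using m unfolding continuous_at_eps_delta by blast
  define \<rho> where "\<rho> = min (r / 2) r3"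
  define C where "C = (B1 * L + B2 * M) * norm N / c"
  have "\<bar>dir_deriv (G (x, t)) \<phi> x\<bar> \<le> C * \<bar>\<phi> x\<bar>"
    if x: "dist x p < \<rho>" and t: "dist t t0 < \<rho>" "t \<in> S" and neg: "\<phi> x < 0" for x t
  proof -
    \<comment> \<open>Following the direction \<open>N\<close>, along which \<open>\<phi>\<close> grows at rate at least \<open>c\<close>, one meets the
      zero set after a time at most \<open>\<bar>\<phi> x\<bar> / c\<close>.\<close>
    define s1 where "s1 = - \<phi> x / c"
    have s1: "s1 \<ge> 0" using neg c by (simp add: s1_def divide_nonpos_pos)
    have "\<bar>\<phi> x\<bar> < m" using r3(2)[of x] x p by (simp add: \<rho>_def dist_real_def)
    hence "s1 \<le> r / (2 * (norm N + 1))"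
      using c neg by (simp add: s1_def m_def field_simps)
    hence "s1 * (norm N + 1) \<le> r / (2 * (norm N + 1)) * (norm N + 1)"
      by (rule mult_right_mono) simp
    also have "\<dots> = r / 2" using norm_ge_zero[of N] by (simp add: field_simps add_nonneg_eq_0_iff)
    finally have s1N: "s1 * norm N \<le> r / 2" using s1 by (simp add: distrib_left)
    have inK: "x + s *\<^sub>R N \<in> cball p r" if "0 \<le> s" "s \<le> s1" for s
    proof -
      have "dist p (x + s *\<^sub>R N) \<le> dist p x + dist x (x + s *\<^sub>R N)" by (rule dist_triangle)
      also have "dist x (x + s *\<^sub>R N) = s * norm N" using that by (simp add: dist_norm)
      also have "\<dots> \<le> s1 * norm N" using that by (intro mult_right_mono) auto
      finally show ?thesis using s1N x by (simp add: \<rho>_def dist_commute)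
    qed
    define \<psi> where "\<psi> s = \<phi> (x + s *\<^sub>R N)" for s
    have \<psi>': "(\<psi> has_real_derivative dir_deriv N \<phi> (x + s *\<^sub>R N)) (at s)" if s: "0 \<le> s" "s \<le> s1" for s
      unfolding \<psi>_def[abs_def]
      by (rule has_real_derivative_along_line) (use \<phi> inK[OF s] KU in auto)
    have cont: "continuous_on {0..s1} \<psi>"
      by (rule DERIV_continuous_on[OF has_field_derivative_at_within[OF \<psi>']]) auto
    have "\<psi> 0 - c * 0 \<le> \<psi> s1 - c * s1"
    proof (rule DERIV_nonneg_imp_increasing_open[where f="\<lambda>s. \<psi> s - c * s"])
      show "0 \<le> s1" by (rule s1)
      show "continuous_on {0..s1} (\<lambda>s. \<psi> s - c * s)" by (intro continuous_intros cont)
      fix s assume s: "0 < s" "s < s1"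
      have "((\<lambda>s. \<psi> s - c * s) has_real_derivative dir_deriv N \<phi> (x + s *\<^sub>R N) - c) (at s)"
        using s by (auto intro!: derivative_eq_intros \<psi>')
      thus "\<exists>y. ((\<lambda>s. \<psi> s - c * s) has_real_derivative y) (at s) \<and> 0 \<le> y"
        using slope[OF inK[of s]] s by auto
    qed
    moreover have "c * s1 = - \<phi> x" using c by (simp add: s1_def)
    ultimately have "0 \<le> \<psi> s1" by (simp add: \<psi>_def)
    then obtain s where s: "0 \<le> s" "s \<le> s1" "\<psi> s = 0"
      using IVT'[of \<psi> 0 0 s1] neg s1 cont by (auto simp: \<psi>_def)
    define y where "y = x + s *\<^sub>R N"
    have xK: "x \<in> cball p r" and yK: "y \<in> cball p r" and tK: "t \<in> cball t0 r"
      using inK[of 0] inK[OF s(1,2)] s1 t r by (auto simp: y_def \<rho>_def dist_commute)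
    have y0: "dir_deriv (G (y, t)) \<phi> y = 0"
      by (rule tangent) (use yK KU s t in \<open>auto simp: y_def \<psi>_def\<close>)
    have "norm (x - y) = s * norm N" using s by (simp add: y_def)
    also have "\<dots> \<le> s1 * norm N" using s by (intro mult_right_mono) auto
    also have "\<dots> = \<bar>\<phi> x\<bar> * norm N / c" using neg by (simp add: s1_def)
    finally have xy: "norm (x - y) \<le> \<bar>\<phi> x\<bar> * norm N / c" .
    have lin: "linear (\<lambda>v. dir_deriv v \<phi> x)" by (rule dir_deriv_linear) (use \<phi> xK KU in auto)
    have "dir_deriv (G (x, t)) \<phi> x = dir_deriv (G (x, t) - G (y, t)) \<phi> x
        + (dir_deriv (G (y, t)) \<phi> x - dir_deriv (G (y, t)) \<phi> y)"
      using linear_diff[OF lin] y0 by simp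
    hence "\<bar>dir_deriv (G (x, t)) \<phi> x\<bar> \<le> norm (dir_deriv (G (x, t) - G (y, t)) \<phi> x)
        + norm (dir_deriv (G (y, t)) \<phi> x - dir_deriv (G (y, t)) \<phi> y)" by simp
    also have "\<dots> \<le> B1 * (L * norm (x - y)) + B2 * norm (x - y) * M"
    proof (rule add_mono)
      show "norm (dir_deriv (G (x, t) - G (y, t)) \<phi> x) \<le> B1 * (L * norm (x - y))"
        by (rule order_trans[OF B1(2)[OF xK]]) (intro mult_left_mono lipG xK yK tK B1(1))
      have "closed_segment x y \<subseteq> cball p r"
        by (rule closed_segment_subset[OF xK yK convex_cball])
      from B2(2)[OF this]
      show "norm (dir_deriv (G (y, t)) \<phi> x - dir_deriv (G (y, t)) \<phi> y) \<le> B2 * norm (x - y) * M"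
        by (rule order_trans) (use M(2) yK tK B2(1) in \<open>auto intro!: mult_left_mono simp del: mem_cball\<close>)
    qed
    also have "\<dots> = (B1 * L + B2 * M) * norm (x - y)" by (simp add: algebra_simps)
    also have "\<dots> \<le> (B1 * L + B2 * M) * (\<bar>\<phi> x\<bar> * norm N / c)"
      using B1(1) L(1) B2(1) M(1) by (intro mult_left_mono xy) auto
    also have "\<dots> = C * \<bar>\<phi> x\<bar>" by (simp add: C_def)
    finally show ?thesis .
  qed
  moreover have "ball p \<rho> \<subseteq> U" using KU r by (auto simp: \<rho>_def)
  moreover have "\<rho> > 0" "C \<ge> 0" using r r3 c B1 B2 L M by (auto simp: \<rho>_def C_def)
  ultimately show ?thesis by blast
qed

lemma dir_deriv_eq_inner_grad:
  fixes f :: "real^3 \<Rightarrow> real"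
  assumes "f differentiable at x"
  shows "dir_deriv v f x = grad f x \<bullet> v"
proof -
  interpret linear "\<lambda>v. dir_deriv v f x" by (rule dir_deriv_linear[OF assms])
  have "dir_deriv v f x = dir_deriv (\<Sum>i\<in>UNIV. (v $ i) *\<^sub>R axis i 1) f x"
    using basis_expansion[of v] by (simp add: scalar_mult_eq_scaleR)
  also have "\<dots> = (\<Sum>i\<in>UNIV. v $ i * dir_deriv (axis i 1) f x)"
    by (simp add: sum scale)
  finally show ?thesis by (simp add: inner_vec_def grad_def pderiv_vec_def mult.commute)
qed

text \<open>A defining function provided at one boundary point thus describes all of the boundary in its
neighbourhood, so that the boundary condition on the velocity may be used at nearby points as well.
Zeros of \<open>\<phi>\<close> are limits of points of \<open>R\<close> since \<open>\<phi>\<close> decreases strictly against its gradient.\<close>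

lemma local_defining_function_frontier:
  assumes R: "open R" and loc: "local_defining_function R p U \<phi>" and y: "y \<in> U"
  shows "y \<in> frontier R \<longleftrightarrow> \<phi> y = 0"
proof
  have U: "open U" and \<phi>: "smooth_on U \<phi>" and g: "\<And>x. x \<in> U \<Longrightarrow> grad \<phi> x \<noteq> 0"
    and RU: "R \<inter> U = {x \<in> U. \<phi> x < 0}"
    using loc unfolding local_defining_function_def by auto
  have C1: "Ck_on (Suc 0) U \<phi>" by (rule smooth_on_open_imp_Ck_on[OF U \<phi>])
  {
    assume "y \<in> frontier R"
    hence cl: "y \<in> closure R" "y \<notin> R" using R by (auto simp: frontier_def interior_open)
    have "open {x \<in> U. \<phi> x > 0}"
      using continuous_open_preimage[OF Ck_on_continuous[OF C1] U, of "{0<..}"]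
      by (simp add: vimage_def Int_def)
    moreover have "{x \<in> U. \<phi> x > 0} \<inter> R = {}"
    proof -
      have "\<phi> x < 0" if "x \<in> U" "x \<in> R" for x using RU that by blast
      thus ?thesis by (auto dest: less_asym)
    qed
    ultimately have "{x \<in> U. \<phi> x > 0} \<inter> closure R = {}" by (simp add: open_Int_closure_eq_empty)
    hence "\<not> \<phi> y > 0" using cl y by blast
    moreover have "\<not> \<phi> y < 0" using RU cl y by blast
    ultimately show "\<phi> y = 0" by simp
  }
  assume y0: "\<phi> y = 0"
  have diff: "\<phi> differentiable at y" using C1 y by simp
  define N where "N = grad \<phi> y"
  have "N \<bullet> N > 0" using g[OF y] by (simp add: N_def)
  have "((\<lambda>s. \<phi> (y - s *\<^sub>R N)) has_real_derivative - (N \<bullet> N)) (at 0)"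
    using has_real_derivative_along_line[of \<phi> y 0 "- N"] diff
    by (simp add: dir_deriv_eq_inner_grad[OF diff] N_def[symmetric])
  from DERIV_neg_dec_right[OF this] \<open>N \<bullet> N > 0\<close>
  obtain d where d: "d > 0" "\<And>h. 0 < h \<Longrightarrow> h < d \<Longrightarrow> \<phi> (y - h *\<^sub>R N) < 0"
    using y0 by auto
  obtain e0 where e0: "e0 > 0" "ball y e0 \<subseteq> U" using U y openE by blast
  have "y \<in> closure R"
    unfolding closure_approachable
  proof (intro allI impI)
    fix e :: real assume e: "e > 0"
    define h where "h = min (d / 2) (min e e0 / (2 * (norm N + 1)))"
    have h: "0 < h" "h < d" using d e e0 by (auto simp: h_def add_nonneg_pos)
    have "h * norm N \<le> h * (norm N + 1)" using h by simp
    also have "\<dots> \<le> min e e0 / (2 * (norm N + 1)) * (norm N + 1)"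
      by (intro mult_right_mono) (auto simp: h_def)
    also have "\<dots> = min e e0 / 2" using norm_ge_zero[of N] by (simp add: field_simps add_nonneg_eq_0_iff)
    finally have "dist (y - h *\<^sub>R N) y < min e e0" using h e e0 by (simp add: dist_norm)
    moreover from this have "y - h *\<^sub>R N \<in> U" using e0 by (auto simp: dist_commute)
    moreover from this have "y - h *\<^sub>R N \<in> R" using d(2)[OF h] RU by blast
    ultimately show "\<exists>z\<in>R. dist z y < e" by (intro bexI[of _ "y - h *\<^sub>R N"]) auto
  qed
  moreover have "y \<notin> R"
  proof
    assume "y \<in> R"
    hence "y \<in> {x \<in> U. \<phi> x < 0}" using y unfolding RU[symmetric] by blast
    thus False using y0 by simp
  qed
  ultimately show "y \<in> frontier R" using R by (simp add: frontier_def interior_open)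
qed

section \<open>Curl, divergence and derivatives in space-time\<close>

lemma has_derivative_slice:
  fixes f :: "'a::real_normed_vector \<times> real \<Rightarrow> 'b::real_normed_vector"
  assumes "f differentiable at (x, t)"
  shows "((\<lambda>y. f (y, t)) has_derivative (\<lambda>v. dir_deriv (v, 0) f (x, t))) (at x)"
proof -
  have "((\<lambda>y. (y, t)) has_derivative (\<lambda>v. (v, 0))) (at x)"
    by (auto intro!: derivative_eq_intros)
  from has_derivative_compose[OF this assms[unfolded frechet_derivative_works]]
  show ?thesis .
qed

lemma has_vector_derivative_time_slice:
  fixes f :: "'a::real_normed_vector \<times> real \<Rightarrow> 'b::real_normed_vector"
  assumes "f differentiable at (x, t)"
  shows "((\<lambda>s. f (x, s)) has_vector_derivative dir_deriv (0, 1) f (x, t)) (at t)"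
proof -
  have "((\<lambda>s. (x, s)) has_derivative (\<lambda>h. (0, h))) (at t)"
    by (auto intro!: derivative_eq_intros)
  from has_derivative_compose[OF this assms[unfolded frechet_derivative_works]]
  have "((\<lambda>s. f (x, s)) has_derivative (\<lambda>h. dir_deriv (h *\<^sub>R (0, 1)) f (x, t))) (at t)" by simp
  thus ?thesis unfolding has_vector_derivative_def
    by (simp only: linear_scale[OF dir_deriv_linear[OF assms]])
qed

lemma has_vector_derivative_along_graph:
  fixes f :: "'a::real_normed_vector \<times> real \<Rightarrow> 'b::real_normed_vector"
  assumes "f differentiable at (x t, t)" "(x has_vector_derivative v) (at t within S)"
  shows "((\<lambda>s. f (x s, s)) has_vector_derivative dir_deriv (v, 1) f (x t, t)) (at t within S)"
proof -
  have "((\<lambda>s. (x s, s)) has_vector_derivative (v, 1)) (at t within S)"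
    by (intro has_vector_derivative_Pair assms(2)) (auto intro!: derivative_eq_intros)
  from vector_derivative_diff_chain_within[OF this has_derivative_at_withinI[OF assms(1)[unfolded frechet_derivative_works]]]
  show ?thesis by (simp add: o_def)
qed

text \<open>A form of the curl that is linear in the derivative \<open>D\<close>, so that it can be differentiated in time
without passing to components.\<close>

lemma curl_eq_sum_cross:
  assumes "(v has_derivative D) (at x)"
  shows "curl v x = (\<Sum>j\<in>UNIV. cross3 (axis j 1) (D (axis j 1)))"
proof -
  have "pderiv_vec j (\<lambda>y. v y $ i) x = D (axis j 1) $ i" for i j
    unfolding pderiv_vec_def
    by (subst frechet_derivative_at[OF bounded_linear.has_derivative[OF bounded_linear_vec_nth assms], symmetric])
       (rule refl)
  thus ?thesis
    by (simp add: curl_def vec_eq_iff forall_3 sum_3 cross3_def axis_def)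
qed

lemma divergence_eq_trace:
  assumes "(v has_derivative D) (at x)"
  shows "divergence v x = (\<Sum>j\<in>UNIV. D (axis j 1) $ j)"
proof -
  have "pderiv_vec j (\<lambda>y. v y $ i) x = D (axis j 1) $ i" for i j
    unfolding pderiv_vec_def
    by (subst frechet_derivative_at[OF bounded_linear.has_derivative[OF bounded_linear_vec_nth assms], symmetric])
       (rule refl)
  thus ?thesis by (simp add: divergence_def)
qed

lemma linear_axis_expansion:
  fixes A :: "real^3 \<Rightarrow> 'b::real_vector"
  assumes "linear A"
  shows "A v = (\<Sum>k\<in>UNIV. (v $ k) *\<^sub>R A (axis k 1))"
proof -
  interpret linear A by fact
  have "A v = A (\<Sum>k\<in>UNIV. (v $ k) *\<^sub>R axis k 1)"
    using basis_expansion[of v] by (simp add: scalar_mult_eq_scaleR)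
  thus ?thesis by (simp add: sum scale)
qed

text \<open>With \<open>A\<close> the velocity gradient and \<open>h\<close> the pressure Hessian, the left-hand side is the curl of the rate
of change of the velocity gradient following the fluid. The Hessian has no curl; the curl of \<open>A\<^sup>2\<close> is
\<open>trace A\<close> times the vorticity minus \<open>A\<close> applied to the vorticity; and the Coriolis term contributes the stretching of
the planetary vorticity \<open>2\<Omega>e\<^sub>3\<close>.\<close>

lemma curl_of_euler_rate:
  fixes A h :: "real^3 \<Rightarrow> real^3" and \<Omega> :: real
  assumes A: "linear A" and trace: "(\<Sum>j\<in>UNIV. A (axis j 1) $ j) = 0"
    and sym: "\<And>i j. h (axis j 1) $ i = h (axis i 1) $ j"
  shows "(\<Sum>j\<in>UNIV. cross3 (axis j 1)
            (- (A (A (axis j 1)) + h (axis j 1) + (2 * \<Omega>) *\<^sub>R cross3 (axis 3 1) (A (axis j 1)))))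
       = A ((\<Sum>j\<in>UNIV. cross3 (axis j 1) (A (axis j 1))) + (2 * \<Omega>) *\<^sub>R axis 3 1)"
proof -
  define m where "m i j = A (axis j 1) $ i" for i j
  have Am: "A v $ i = v $ 1 * m i 1 + v $ 2 * m i 2 + v $ 3 * m i 3" for v i
    by (subst linear_axis_expansion[OF A]) (simp add: sum_3 m_def)
  have e: "axis 1 (1::real) $ (1::3) = 1" "axis 1 (1::real) $ (2::3) = 0" "axis 1 (1::real) $ (3::3) = 0"
    "axis 2 (1::real) $ (1::3) = 0" "axis 2 (1::real) $ (2::3) = 1" "axis 2 (1::real) $ (3::3) = 0"
    "axis 3 (1::real) $ (1::3) = 0" "axis 3 (1::real) $ (2::3) = 0" "axis 3 (1::real) $ (3::3) = 1"
    by (simp_all add: axis_def)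
  have m33: "m 3 3 = - m 1 1 - m 2 2" using trace by (simp add: sum_3 m_def)
  have s: "h (axis 2 1) $ 1 = h (axis 1 1) $ 2" "h (axis 3 1) $ 1 = h (axis 1 1) $ 3"
    "h (axis 3 1) $ 2 = h (axis 2 1) $ 3" by (rule sym)+
  show ?thesis
    by (simp add: vec_eq_iff forall_3 sum_3 cross_components Am e s m33) (simp add: algebra_simps)
qed

lemma bounded_linear_cross3: "bounded_linear (cross3 c)"
  unfolding linear_conv_bounded_linear[symmetric]
  by (rule linearI) (simp_all add: cross_add_right cross_mult_right)

section \<open>Particle paths of the fluid stay in the domain\<close>

text \<open>Differentiability at the closed ends of the time interval and at the boundary of \<open>R\<close> is meaningful
only through an extension, so calculations are done with the smooth extension \<open>G\<close> of the velocity to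
the open set \<open>W\<close> of space-time.\<close>

locale euler_flow =
  fixes \<Omega> T :: real and R :: "(real^3) set" and u :: "real^3 \<Rightarrow> real \<Rightarrow> real^3"
    and \<pi> :: "real^3 \<Rightarrow> real \<Rightarrow> real" and X :: "real^3 \<Rightarrow> real \<Rightarrow> real^3"
    and G :: "(real^3) \<times> real \<Rightarrow> real^3" and W :: "((real^3) \<times> real) set"
  assumes T: "T > 0" and domain: "smooth_domain R"
    and euler: "rotating_euler_solution \<Omega> R T u \<pi>" and path: "lagrangian_path_map R T u X"
    and W: "open W" "Sigma (closure R) (\<lambda>_. {0..T}) \<subseteq> W"
    and G: "\<And>k. Ck_on k W G" and G_eq: "\<And>x t. x \<in> closure R \<Longrightarrow> t \<in> {0..T} \<Longrightarrow> G (x, t) = u x t"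
begin

lemma R_open: "open R"
  using domain by (simp add: smooth_domain_def)

lemma in_W: "x \<in> closure R \<Longrightarrow> t \<in> {0..T} \<Longrightarrow> (x, t) \<in> W"
  using W by auto

lemma closureI: "x \<in> R \<Longrightarrow> x \<in> closure R"
  using closure_subset by blast

lemma path_in_closure: "a \<in> R \<Longrightarrow> t \<in> {0..T} \<Longrightarrow> X a t \<in> closure R"
  and path_initial: "a \<in> R \<Longrightarrow> X a 0 = a"
  using path by (auto simp: lagrangian_path_map_def)

lemma path_deriv:
  assumes "a \<in> R" "t \<in> {0..T}"
  shows "(X a has_vector_derivative G (X a t, t)) (at t within {0..T})"
  using path assms path_in_closure[OF assms] by (simp add: lagrangian_path_map_def G_eq)

lemma path_continuous: "a \<in> R \<Longrightarrow> continuous_on {0..T} (X a)"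
  using path_deriv has_vector_derivative_continuous continuous_on_eq_continuous_within by blast

text \<open>A defining function at \<open>p\<close> is also one at every other point of its domain \<open>U\<close>, so that its normalised gradient
is an outward normal at each of its zeros and not at \<open>p\<close> alone.\<close>

lemma velocity_tangential:
  assumes loc: "local_defining_function R p U \<phi>" and y: "y \<in> U" "\<phi> y = 0" and t: "t \<in> {0..T}"
  shows "dir_deriv (G (y, t)) \<phi> y = 0"
proof -
  have U: "open U" and \<phi>: "smooth_on U \<phi>" and g: "grad \<phi> y \<noteq> 0"
    using loc y unfolding local_defining_function_def by auto
  have fr: "y \<in> frontier R" using local_defining_function_frontier[OF R_open loc y(1)] y by simp
  have "local_defining_function R y U \<phi>"
    using loc y unfolding local_defining_function_def by auto
  hence "outward_unit_normal R y (grad \<phi> y /\<^sub>R norm (grad \<phi> y))"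
    unfolding outward_unit_normal_def by blast
  hence "u y t \<bullet> (grad \<phi> y /\<^sub>R norm (grad \<phi> y)) = 0"
    using euler fr t unfolding rotating_euler_solution_def by blast
  hence "grad \<phi> y \<bullet> u y t = 0" using g by (simp add: inner_commute)
  moreover have "G (y, t) = u y t" by (rule G_eq[OF _ t]) (use fr in \<open>simp add: frontier_def\<close>)
  moreover have "\<phi> differentiable at y"
    using smooth_on_open_imp_Ck_on[OF U \<phi>, of "Suc 0"] y by simp
  ultimately show ?thesis by (simp add: dir_deriv_eq_inner_grad)
qed

text \<open>Consider the first time \<open>t0\<close> outside \<open>R\<close>. Shortly before it, the defining function \<open>\<phi>\<close> at the exit point
is negative along the path and satisfies \<open>\<phi>' \<le> C \<bar>\<phi>\<bar>\<close>. Then \<open>- exp (C s) \<phi>\<close> is positive and nondecreasing,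
which is incompatible with \<open>\<phi> = 0\<close> at \<open>t0\<close>.\<close>

theorem path_stays_inside:
  assumes a: "a \<in> R" and t: "t \<in> {0..T}"
  shows "X a t \<in> R"
proof (rule ccontr)
  assume out: "X a t \<notin> R"
  define S where "S = {0..T} \<inter> (X a -` (- R))"
  have "closed S" unfolding S_def
    by (rule continuous_closed_preimage[OF path_continuous[OF a]]) (use R_open in auto)
  hence "compact ({0..T} \<inter> S)" by (rule compact_Int_closed[OF compact_Icc])
  moreover have "{0..T} \<inter> S = S" by (auto simp: S_def)
  ultimately have "compact S" by simp
  moreover have "t \<in> S" using out t by (simp add: S_def)
  ultimately obtain t0 where t0: "t0 \<in> S" "\<And>s. s \<in> S \<Longrightarrow> t0 \<le> s"
    using compact_attains_inf[of S] by (metis empty_iff)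
  define p where "p = X a t0"
  have t0T: "t0 \<in> {0..T}" and pR: "p \<notin> R" using t0 by (auto simp: S_def p_def)
  have "t0 \<noteq> 0" using pR a path_initial[OF a] by (auto simp: p_def)
  hence t0pos: "t0 > 0" using t0T by simp
  have before: "X a s \<in> R" if "0 \<le> s" "s < t0" for s
    using t0(2)[of s] that t0T by (force simp: S_def)
  have "p \<in> frontier R"
    using path_in_closure[OF a t0T] pR R_open by (simp add: frontier_def interior_open p_def)
  then obtain U \<phi> where loc: "local_defining_function R p U \<phi>"
    using domain unfolding smooth_domain_def by blast
  have U: "open U" "p \<in> U" and \<phi>: "smooth_on U \<phi>" and g: "grad \<phi> p \<noteq> 0"
    and RU: "R \<inter> U = {x \<in> U. \<phi> x < 0}"
    using loc unfolding local_defining_function_def by auto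
  have \<phi>p: "\<phi> p = 0" using local_defining_function_frontier[OF R_open loc U(2)] \<open>p \<in> frontier R\<close> by simp
  have C2: "Ck_on (Suc (Suc 0)) U \<phi>" by (rule smooth_on_open_imp_Ck_on[OF U(1) \<phi>])
  have diff: "\<phi> differentiable at x" if "x \<in> U" for x using C2 that by simp
  have N: "dir_deriv (grad \<phi> p) \<phi> p > 0" using g by (simp add: dir_deriv_eq_inner_grad[OF diff[OF U(2)]])
  obtain \<rho> C where \<rho>: "\<rho> > 0" "ball p \<rho> \<subseteq> U" and C: "C \<ge> 0"
    and rate: "\<And>x s. dist x p < \<rho> \<Longrightarrow> dist s t0 < \<rho> \<Longrightarrow> s \<in> {0..T} \<Longrightarrow> \<phi> x < 0 \<Longrightarrow>
      \<bar>dir_deriv (G (x, s)) \<phi> x\<bar> \<le> C * \<bar>\<phi> x\<bar>"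
  proof -
    have "(p, t0) \<in> W" using in_W[OF path_in_closure[OF a t0T] t0T] by (simp add: p_def)
    from tangential_rate_bound[where S="{0..T}", OF U C2 \<phi>p N W(1) this G velocity_tangential[OF loc]]
    show thesis using that by blast
  qed
  obtain \<eta> where \<eta>: "\<eta> > 0" "\<And>s. s \<in> {0..T} \<Longrightarrow> dist s t0 < \<eta> \<Longrightarrow> dist (X a s) p < \<rho>"
    using path_continuous[OF a] t0T \<rho>(1) unfolding continuous_on_iff p_def by metis
  define s1 where "s1 = max 0 (t0 - min \<eta> \<rho> / 2)"
  have s1: "0 \<le> s1" "s1 < t0" "t0 - s1 < \<eta>" "t0 - s1 < \<rho>" using t0pos \<eta> \<rho> by (auto simp: s1_def)
  have near: "s \<in> {0..T}" "dist (X a s) p < \<rho>" "dist s t0 < \<rho>" "X a s \<in> U" if "s \<in> {s1..t0}" for s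
  proof -
    show sT: "s \<in> {0..T}" and "dist s t0 < \<rho>" using that s1 t0T by (auto simp: dist_real_def)
    have "dist s t0 < \<eta>" using that s1 by (auto simp: dist_real_def)
    thus "dist (X a s) p < \<rho>" by (rule \<eta>(2)[OF sT])
    thus "X a s \<in> U" using \<rho>(2) by (auto simp: dist_commute)
  qed
  define q where "q s = - (exp (C * s) * \<phi> (X a s))" for s
  have q': "(q has_real_derivative - (exp (C * s) * (C * \<phi> (X a s) + dir_deriv (G (X a s, s)) \<phi> (X a s))))
      (at s within {0..T})" if s: "s \<in> {s1..t0}" for s
  proof -
    have "(\<phi> has_derivative (\<lambda>v. dir_deriv v \<phi> (X a s))) (at (X a s) within X a ` {0..T})"
      by (rule has_derivative_at_withinI[OF Ck_on_has_derivative[OF C2 near(4)[OF s]]])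
    from vector_derivative_diff_chain_within[OF path_deriv[OF a near(1)[OF s]] this]
    have [derivative_intros]: "((\<lambda>s. \<phi> (X a s)) has_real_derivative dir_deriv (G (X a s, s)) \<phi> (X a s))
        (at s within {0..T})"
      by (simp add: o_def has_real_derivative_iff_has_vector_derivative)
    show ?thesis unfolding q_def by (auto intro!: derivative_eq_intros simp: algebra_simps)
  qed
  have "q s1 \<le> q t0"
  proof (rule DERIV_nonneg_imp_increasing_open[where f=q])
    show "s1 \<le> t0" using s1 by simp
    show "continuous_on {s1..t0} q"
      by (rule DERIV_continuous_on[OF DERIV_subset[OF q']]) (use s1 t0T in auto)
    fix s assume s: "s1 < s" "s < t0"
    hence sI: "s \<in> {s1..t0}" by simp
    have neg: "\<phi> (X a s) < 0" using before[of s] near(4)[OF sI] RU s s1 by auto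
    have "dir_deriv (G (X a s, s)) \<phi> (X a s) \<le> C * \<bar>\<phi> (X a s)\<bar>"
      using rate[OF near(2,3,1)[OF sI] neg] by simp
    hence "C * \<phi> (X a s) + dir_deriv (G (X a s, s)) \<phi> (X a s) \<le> 0" using neg by simp
    hence "0 \<le> - (exp (C * s) * (C * \<phi> (X a s) + dir_deriv (G (X a s, s)) \<phi> (X a s)))"
      by (simp add: mult_nonneg_nonpos)
    moreover have "at s within {0..T} = at s" using s s1 t0T by (intro at_within_Icc_at) auto
    ultimately show "\<exists>y. DERIV q s :> y \<and> 0 \<le> y" using q'[OF sI] by auto
  qed
  moreover have "\<phi> (X a s1) < 0" using before[of s1] near(4)[of s1] RU s1 by auto
  ultimately show False by (simp add: q_def p_def[symmetric] \<phi>p mult_less_0_iff not_less[symmetric])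
qed

section \<open>Transport of the absolute vorticity\<close>

lemma G_diff:
  assumes "x \<in> R" "t \<in> {0..T}"
  shows "G differentiable at (x, t)" "dir_deriv v G differentiable at (x, t)"
  using G[of "Suc 0"] Ck_on_dir_deriv[OF G[of "Suc (Suc 0)"], of v] in_W[OF closureI[OF assms(1)] assms(2)]
  by simp_all

lemma linear_velocity_gradient:
  assumes "x \<in> R" "t \<in> {0..T}"
  shows "linear (\<lambda>v. dir_deriv (v, 0) G (x, t))"
  using has_derivative_linear[OF has_derivative_slice[OF G_diff(1)[OF assms]]] .

lemma u_has_derivative:
  assumes "x \<in> R" "t \<in> {0..T}"
  shows "((\<lambda>y. u y t) has_derivative (\<lambda>v. dir_deriv (v, 0) G (x, t))) (at x)"
  by (rule has_derivative_transform_within_open[OF has_derivative_slice[OF G_diff(1)[OF assms]] R_open assms(1)])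
     (rule G_eq[OF closureI assms(2)])

lemma vorticity_eq:
  assumes "x \<in> R" "t \<in> {0..T}"
  shows "vorticity u x t = (\<Sum>j\<in>UNIV. cross3 (axis j 1) (dir_deriv (axis j 1, 0) G (x, t)))"
  unfolding vorticity_def by (rule curl_eq_sum_cross[OF u_has_derivative[OF assms]])

lemma velocity_gradient_trace:
  assumes "x \<in> R" "t \<in> {0..T}"
  shows "(\<Sum>j\<in>UNIV. dir_deriv (axis j 1, 0) G (x, t) $ j) = 0"
  using euler assms divergence_eq_trace[OF u_has_derivative[OF assms]]
  by (simp add: rotating_euler_solution_def)

lemma pressure_C2: "t \<in> {0..T} \<Longrightarrow> Ck_on (Suc (Suc 0)) R (\<lambda>y. \<pi> y t)"
  using euler by (intro smooth_on_open_imp_Ck_on[OF R_open]) (simp add: rotating_euler_solution_def)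

definition pressure_hessian :: "real^3 \<Rightarrow> real \<Rightarrow> real^3 \<Rightarrow> real^3" where
  "pressure_hessian x t v = (\<chi> i. dir_deriv v (dir_deriv (axis i 1) (\<lambda>y. \<pi> y t)) x)"

lemma grad_pressure_has_derivative:
  assumes "x \<in> R" "t \<in> {0..T}"
  shows "(grad (\<lambda>y. \<pi> y t) has_derivative pressure_hessian x t) (at x)"
  unfolding has_derivative_componentwise_within[where f="grad _"]
proof
  fix b :: "real^3" assume "b \<in> Basis"
  then obtain i where b: "b = axis i 1" by (auto simp: Basis_vec_def)
  show "((\<lambda>y. grad (\<lambda>z. \<pi> z t) y \<bullet> b) has_derivative (\<lambda>v. pressure_hessian x t v \<bullet> b)) (at x)"
    using Ck_on_has_derivative[OF Ck_on_dir_deriv[OF pressure_C2[OF assms(2)]] assms(1)]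
    by (simp add: b inner_axis grad_def pressure_hessian_def pderiv_vec_def)
qed

lemma pressure_hessian_symmetric:
  assumes "x \<in> R" "t \<in> {0..T}"
  shows "pressure_hessian x t (axis j 1) $ i = pressure_hessian x t (axis i 1) $ j"
  unfolding pressure_hessian_def
  using C2_dir_deriv_symmetric[OF R_open assms(1) pressure_C2[OF assms(2)]] by simp

text \<open>The one-sided time derivative of \<open>u\<close> in the equation of motion is the ordinary one of the extension.\<close>

lemma euler_extended:
  assumes "x \<in> R" "t \<in> {0..T}"
  shows "dir_deriv (0, 1) G (x, t) + (\<Sum>j\<in>UNIV. (G (x, t) $ j) *\<^sub>R dir_deriv (axis j 1, 0) G (x, t))
      + grad (\<lambda>y. \<pi> y t) x + (2 * \<Omega>) *\<^sub>R cross3 (axis 3 1) (G (x, t)) = 0"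
proof -
  have "((\<lambda>s. u x s) has_vector_derivative dir_deriv (0, 1) G (x, t)) (at t within {0..T})"
    by (rule has_vector_derivative_transform[OF assms(2) _
          has_vector_derivative_at_within[OF has_vector_derivative_time_slice[OF G_diff(1)[OF assms]]]])
       (simp add: G_eq closureI assms)
  hence "vector_derivative (\<lambda>s. u x s) (at t within {0..T}) = dir_deriv (0, 1) G (x, t)"
    using vector_derivative_within_closed_interval[OF T] assms(2) by simp
  moreover have "pderiv_vec j (\<lambda>y. u y t) x = dir_deriv (axis j 1, 0) G (x, t)" for j
    unfolding pderiv_vec_def by (subst frechet_derivative_at[OF u_has_derivative[OF assms], symmetric]) (rule refl)
  moreover have "vector_derivative (\<lambda>s. u x s) (at t within {0..T})
      + advection (\<lambda>y. u y t) (\<lambda>y. u y t) x + grad (\<lambda>y. \<pi> y t) x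
      + (2 * \<Omega>) *\<^sub>R cross3 (axis 3 1) (u x t) = 0"
    using euler assms unfolding rotating_euler_solution_def by blast
  ultimately show ?thesis
    unfolding advection_def G_eq[OF closureI[OF assms(1)] assms(2)] by simp
qed

text \<open>At a fixed time the left-hand side of the equation of motion vanishes identically on the open set \<open>R\<close>,
hence so does its derivative in every spatial direction. The advection term yields two terms: one with the second
derivatives of the velocity, to be absorbed in the derivative following the fluid, and
the square of the velocity gradient.\<close>

lemma euler_differentiated:
  assumes "x \<in> R" "t \<in> {0..T}"
  shows "dir_deriv (v, 0) (dir_deriv (0, 1) G) (x, t)
      + (\<Sum>j\<in>UNIV. (G (x, t) $ j) *\<^sub>R dir_deriv (v, 0) (dir_deriv (axis j 1, 0) G) (x, t))
      + dir_deriv (dir_deriv (v, 0) G (x, t), 0) G (x, t)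
      + pressure_hessian x t v + (2 * \<Omega>) *\<^sub>R cross3 (axis 3 1) (dir_deriv (v, 0) G (x, t)) = 0"
proof -
  let ?E = "\<lambda>y. dir_deriv (0, 1) G (y, t) + (\<Sum>j\<in>UNIV. (G (y, t) $ j) *\<^sub>R dir_deriv (axis j 1, 0) G (y, t))
      + grad (\<lambda>z. \<pi> z t) y + (2 * \<Omega>) *\<^sub>R cross3 (axis 3 1) (G (y, t))"
  let ?D = "\<lambda>v. dir_deriv (v, 0) (dir_deriv (0, 1) G) (x, t)
      + (\<Sum>j\<in>UNIV. (G (x, t) $ j) *\<^sub>R dir_deriv (v, 0) (dir_deriv (axis j 1, 0) G) (x, t)
           + (dir_deriv (v, 0) G (x, t) $ j) *\<^sub>R dir_deriv (axis j 1, 0) G (x, t))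
      + pressure_hessian x t v + (2 * \<Omega>) *\<^sub>R cross3 (axis 3 1) (dir_deriv (v, 0) G (x, t))"
  note slice = has_derivative_slice[OF G_diff(1)[OF assms]] has_derivative_slice[OF G_diff(2)[OF assms]]
  have "(?E has_derivative ?D) (at x)"
    by (intro has_derivative_add has_derivative_sum has_derivative_scaleR slice
          bounded_linear.has_derivative[OF bounded_linear_vec_nth]
          bounded_linear.has_derivative[OF bounded_linear_scaleR_right]
          bounded_linear.has_derivative[OF bounded_linear_cross3] grad_pressure_has_derivative assms)
  moreover have "(?E has_derivative (\<lambda>v. 0)) (at x)"
    by (rule has_derivative_transform_within_open[OF has_derivative_const R_open assms(1)])
       (simp add: euler_extended[OF _ assms(2)])
  ultimately have "?D = (\<lambda>v. 0)" by (rule has_derivative_unique)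
  hence "?D v = 0" by meson
  thus ?thesis
    using linear_axis_expansion[OF linear_velocity_gradient[OF assms], of "dir_deriv (v, 0) G (x, t)"]
    by (simp add: sum.distrib algebra_simps)
qed

text \<open>By symmetry of the second derivatives, the derivative of \<open>\<partial>\<^sub>v G\<close> in the space-time direction \<open>(G, 1)\<close> of
the path consists of the time derivative and the second order advection term of the differentiated equation of motion.\<close>

lemma velocity_gradient_along_path:
  assumes a: "a \<in> R" and t: "t \<in> {0..T}"
  defines "p \<equiv> (X a t, t)"
  shows "((\<lambda>s. dir_deriv (v, 0) G (X a s, s)) has_vector_derivative
      - (dir_deriv (dir_deriv (v, 0) G p, 0) G p + pressure_hessian (X a t) t v
         + (2 * \<Omega>) *\<^sub>R cross3 (axis 3 1) (dir_deriv (v, 0) G p))) (at t within {0..T})"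
proof -
  have x: "X a t \<in> R" by (rule path_stays_inside[OF a t])
  have sym: "dir_deriv w (dir_deriv (v, 0) G) p = dir_deriv (v, 0) (dir_deriv w G) p" for w
    using C2_dir_deriv_symmetric[OF W(1) in_W[OF closureI[OF x] t] G] by (simp add: p_def)
  have "dir_deriv (G p, 1) (dir_deriv (v, 0) G) p
      = dir_deriv (0, 1) (dir_deriv (v, 0) G) p + dir_deriv (G p, 0) (dir_deriv (v, 0) G) p"
    using linear_add[OF dir_deriv_linear[OF G_diff(2)[OF x t, of "(v, 0)"]], of "(0, 1)" "(G p, 0)"]
    by (simp add: p_def)
  also have "dir_deriv (G p, 0) (dir_deriv (v, 0) G) p
      = (\<Sum>j\<in>UNIV. (G p $ j) *\<^sub>R dir_deriv (axis j 1, 0) (dir_deriv (v, 0) G) p)"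
    unfolding p_def
    by (rule linear_axis_expansion[OF has_derivative_linear[OF has_derivative_slice[OF G_diff(2)[OF x t]]]])
  finally have "dir_deriv (G p, 1) (dir_deriv (v, 0) G) p
    = - (dir_deriv (dir_deriv (v, 0) G p, 0) G p + pressure_hessian (X a t) t v
         + (2 * \<Omega>) *\<^sub>R cross3 (axis 3 1) (dir_deriv (v, 0) G p))"
    using euler_differentiated[OF x t, of v] unfolding p_def[symmetric] sym eq_neg_iff_add_eq_0
    by (simp only: add.assoc)
  moreover have "((\<lambda>s. dir_deriv (v, 0) G (X a s, s)) has_vector_derivative
      dir_deriv (G p, 1) (dir_deriv (v, 0) G) p) (at t within {0..T})"
    unfolding p_def by (rule has_vector_derivative_along_graph[OF G_diff(2)[OF x t] path_deriv[OF a t]])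
  ultimately show ?thesis by simp
qed

text \<open>The vorticity equation: the absolute vorticity is stretched by the velocity gradient, that is, it
solves the variational equation of the flow.\<close>

theorem absolute_vorticity_along_path:
  assumes a: "a \<in> R" and t: "t \<in> {0..T}"
  shows "((\<lambda>s. vorticity u (X a s) s + (2 * \<Omega>) *\<^sub>R axis 3 1) has_vector_derivative
      dir_deriv (vorticity u (X a t) t + (2 * \<Omega>) *\<^sub>R axis 3 1, 0) G (X a t, t)) (at t within {0..T})"
proof -
  have x: "X a t \<in> R" by (rule path_stays_inside[OF a t])
  have "((\<lambda>s. (\<Sum>j\<in>UNIV. cross3 (axis j 1) (dir_deriv (axis j 1, 0) G (X a s, s))) + (2 * \<Omega>) *\<^sub>R axis 3 1)
      has_vector_derivative (\<Sum>j\<in>UNIV. cross3 (axis j 1)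
        (- (dir_deriv (dir_deriv (axis j 1, 0) G (X a t, t), 0) G (X a t, t)
         + pressure_hessian (X a t) t (axis j 1)
         + (2 * \<Omega>) *\<^sub>R cross3 (axis 3 1) (dir_deriv (axis j 1, 0) G (X a t, t))))) + 0) (at t within {0..T})"
    by (intro has_vector_derivative_add has_vector_derivative_sum has_vector_derivative_const
        bounded_linear.has_vector_derivative[OF bounded_linear_cross3] velocity_gradient_along_path a t)
  hence "((\<lambda>s. (\<Sum>j\<in>UNIV. cross3 (axis j 1) (dir_deriv (axis j 1, 0) G (X a s, s))) + (2 * \<Omega>) *\<^sub>R axis 3 1)
      has_vector_derivative
        dir_deriv (vorticity u (X a t) t + (2 * \<Omega>) *\<^sub>R axis 3 1, 0) G (X a t, t)) (at t within {0..T})"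
    unfolding add_0_right vorticity_eq[OF x t]
    by (subst (asm) curl_of_euler_rate[OF linear_velocity_gradient[OF x t] velocity_gradient_trace[OF x t]
          pressure_hessian_symmetric[OF x t]])
  thus ?thesis
    by (rule has_vector_derivative_transform[OF t, rotated])
       (simp add: vorticity_eq path_stays_inside[OF a])
qed

text \<open>The absolute vorticity along the path solves the variational equation, so the derivative of the flow
carries its initial value to its value at time \<open>t\<close>.\<close>

theorem cauchy_vorticity_formula:
  assumes a: "a \<in> R" and t: "t \<in> {0..T}"
  shows "(\<lambda>b. X b t) differentiable at a"
    and "dir_deriv (initial_vorticity u a + (2 * \<Omega>) *\<^sub>R axis 3 1) (\<lambda>b. X b t) a
      = vorticity u (X a t) t + (2 * \<Omega>) *\<^sub>R axis 3 1"
proof -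
  interpret flow_around_trajectory G W X R a T
    by unfold_locales
      (use W(1) G R_open a in_W path_in_closure[OF a] in \<open>auto intro: path_initial path_deriv simp del: Ck_on.simps\<close>)
  show "(\<lambda>b. X b t) differentiable at a" by (rule flow_differentiable[OF t])
  have "dir_deriv (vorticity u (X a 0) 0 + (2 * \<Omega>) *\<^sub>R axis 3 1) (\<lambda>b. X b t) a
      = vorticity u (X a t) t + (2 * \<Omega>) *\<^sub>R axis 3 1"
    by (rule flow_derivative_transports[OF _ t]) (simp only: A_def absolute_vorticity_along_path[OF a])
  thus "dir_deriv (initial_vorticity u a + (2 * \<Omega>) *\<^sub>R axis 3 1) (\<lambda>b. X b t) a
      = vorticity u (X a t) t + (2 * \<Omega>) *\<^sub>R axis 3 1"
    by (simp add: path_initial[OF a] initial_vorticity_def)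
qed

end

theorem theorem3:
  fixes \<Omega> T :: real and R :: "(real^3) set"
    and u X :: "real^3 \<Rightarrow> real \<Rightarrow> real^3" and \<pi> :: "real^3 \<Rightarrow> real \<Rightarrow> real"
  assumes "\<Omega> > 0" and "T > 0"
    and "smooth_domain R"
    and "rotating_euler_solution \<Omega> R T u \<pi>"
    and "lagrangian_path_map R T u X"
    and "\<forall>a\<in>R. local_rossby \<Omega> u a < 2"
  shows "\<forall>a\<in>R. \<forall>t\<in>{0..T}.
    (\<lambda>b. displacement X b t) differentiable (at a) \<and>
    pderiv_vec 3 (\<lambda>b. displacement X b t $ 3) a
      + eps \<Omega> u 1 a * pderiv_vec 1 (\<lambda>b. displacement X b t $ 3) a
      + eps \<Omega> u 2 a * pderiv_vec 2 (\<lambda>b. displacement X b t $ 3) a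
    = 1 / (2 * \<Omega> * (1 + initial_vorticity u a $ 3 / (2 * \<Omega>)))
        * (vorticity u (X a t) t $ 3 - initial_vorticity u a $ 3)"
proof (intro ballI)
  fix a t assume a: "a \<in> R" and t: "t \<in> {0..T}"
  have "smooth_on (Sigma (closure R) (\<lambda>_. {0..T})) (\<lambda>(x, t). u x t)"
    using assms(4) by (simp add: rotating_euler_solution_def)
  then obtain W G where W: "open W" "Sigma (closure R) (\<lambda>_. {0..T}) \<subseteq> W"
    and G: "\<And>k. Ck_on k W G"
    and G_eq: "\<And>q. q \<in> Sigma (closure R) (\<lambda>_. {0..T}) \<Longrightarrow> G q = (\<lambda>(x, t). u x t) q"
    by (rule smooth_on_extension) (rule that)
  interpret euler_flow \<Omega> T R u \<pi> X G W
    by unfold_locales (use assms W G G_eq in \<open>auto simp del: Ck_on.simps\<close>)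
  define \<zeta> where "\<zeta> = initial_vorticity u a"
  define D where "D v = dir_deriv v (\<lambda>b. X b t) a" for v
  have X_diff: "(\<lambda>b. X b t) differentiable at a" by (rule cauchy_vorticity_formula(1)[OF a t])
  have D_deriv: "((\<lambda>b. X b t) has_derivative D) (at a)"
    using X_diff unfolding D_def[abs_def] by (simp add: frechet_derivative_works)
  have displacement_deriv: "((\<lambda>b. displacement X b t) has_derivative (\<lambda>v. D v - v)) (at a)"
    unfolding displacement_def by (intro has_derivative_diff D_deriv has_derivative_ident)
  have "pderiv_vec j (\<lambda>b. displacement X b t $ 3) a = (D (axis j 1) - axis j 1) $ 3" for j
    unfolding pderiv_vec_def
    by (subst frechet_derivative_at[OF bounded_linear.has_derivative[OF bounded_linear_vec_nth displacement_deriv], symmetric])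
       (rule refl)
  hence pd: "pderiv_vec 1 (\<lambda>b. displacement X b t $ 3) a = D (axis 1 1) $ 3"
    "pderiv_vec 2 (\<lambda>b. displacement X b t $ 3) a = D (axis 2 1) $ 3"
    "pderiv_vec 3 (\<lambda>b. displacement X b t $ 3) a = D (axis 3 1) $ 3 - 1"
    by (simp_all add: axis_def)
  have "D (\<zeta> + (2 * \<Omega>) *\<^sub>R axis 3 1) $ 3
      = \<zeta> $ 1 * D (axis 1 1) $ 3 + \<zeta> $ 2 * D (axis 2 1) $ 3 + (\<zeta> $ 3 + 2 * \<Omega>) * D (axis 3 1) $ 3"
    by (subst linear_axis_expansion[OF has_derivative_linear[OF D_deriv]]) (simp add: sum_3 axis_def)
  moreover have "D (\<zeta> + (2 * \<Omega>) *\<^sub>R axis 3 1) $ 3 = vorticity u (X a t) t $ 3 + 2 * \<Omega>"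
    using cauchy_vorticity_formula(2)[OF a t] by (simp add: D_def \<zeta>_def)
  ultimately have cauchy3: "\<zeta> $ 1 * D (axis 1 1) $ 3 + \<zeta> $ 2 * D (axis 2 1) $ 3
      + (\<zeta> $ 3 + 2 * \<Omega>) * (D (axis 3 1) $ 3 - 1) = vorticity u (X a t) t $ 3 - \<zeta> $ 3"
    by (simp add: algebra_simps)
  have "norm \<zeta> < 2 * \<Omega>"
    using assms(1,6) a by (auto simp: local_rossby_def \<zeta>_def divide_less_eq)
  hence pos: "\<zeta> $ 3 + 2 * \<Omega> \<noteq> 0" using component_le_norm_cart[of \<zeta> 3] by linarith
  \<comment> \<open>The common denominator is the third component of the initial absolute vorticity.\<close>
  have scale: "2 * \<Omega> * (1 + \<zeta> $ 3 / (2 * \<Omega>)) = \<zeta> $ 3 + 2 * \<Omega>"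
    using assms(1) by (simp add: field_simps)
  have "pderiv_vec 3 (\<lambda>b. displacement X b t $ 3) a
      + eps \<Omega> u 1 a * pderiv_vec 1 (\<lambda>b. displacement X b t $ 3) a
      + eps \<Omega> u 2 a * pderiv_vec 2 (\<lambda>b. displacement X b t $ 3) a
    = 1 / (2 * \<Omega> * (1 + initial_vorticity u a $ 3 / (2 * \<Omega>)))
        * (vorticity u (X a t) t $ 3 - initial_vorticity u a $ 3)"
    unfolding eps_def pd \<zeta>_def[symmetric] scale cauchy3[symmetric]
    using pos by (simp add: distrib_left)
  thus "(\<lambda>b. displacement X b t) differentiable (at a) \<and>
    pderiv_vec 3 (\<lambda>b. displacement X b t $ 3) a
      + eps \<Omega> u 1 a * pderiv_vec 1 (\<lambda>b. displacement X b t $ 3) a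
      + eps \<Omega> u 2 a * pderiv_vec 2 (\<lambda>b. displacement X b t $ 3) a
    = 1 / (2 * \<Omega> * (1 + initial_vorticity u a $ 3 / (2 * \<Omega>)))
        * (vorticity u (X a t) t $ 3 - initial_vorticity u a $ 3)"
    using displacement_deriv differentiable_def by blast
qed

end
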